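(* Let $N$ be a connected 2-step nilpotent Lie group with left-invariant pseudo-Riemannian metric tensor $\langle\,,\rangle$ and Lie algebra $\mathfrak n=\mathfrak U\oplus\mathfrak Z\oplus\mathfrak V\oplus\mathfrak E$. For all $u,u'\in\mathfrak U$, $z,z'\in\mathfrak Z$, $v,v'\in\mathfrak V$, $e,e'\in\mathfrak E$, and $x\in\mathfrak V\oplus\mathfrak E$, the Levi-Civita connection $\nabla$ (on left-invariant vector fields) satisfies $$\nabla_uu'=\nabla_uz=\nabla_zu=\nabla_zz'=0,$$ $$\nabla_uv=\nabla_vu=\nabla_ue=\nabla_eu=0,$$ $$\nabla_zx=\nabla_xz=-\tfrac12\iota j(\iota z)x,$$ $$\nabla_vv'=\tfrac12\big([v,v']-\iota j(\iota v)v'-\iota j(\iota v')v\big),$$ $$\nabla_ve=\tfrac12\big([v,e]-\iota j(\iota v)e\big),\qquad \nabla_ev=\tfrac12\big([e,v]-\iota j(\iota v)e\big),$$ $$\nabla_ee'=\tfrac12[e,e'].$$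
   Context: An inner product is a nondegenerate symmetric bilinear form. $\mathfrak n$ has center $\mathfrak z$, $[\mathfrak n,\mathfrak n]\subseteq\mathfrak z$. Decomposition: $\mathfrak U=\mathfrak z\cap\mathfrak z^\perp$; $\mathfrak V$ is a chosen totally null subspace with $\dim\mathfrak V=\dim\mathfrak U$, dually paired with $\mathfrak U$ by $\langle\,,\rangle$; $\mathfrak Z=\mathfrak z\cap\mathfrak U^\perp\cap\mathfrak V^\perp$; $\mathfrak E$ is the orthogonal complement of $\mathfrak Z$ in $\mathfrak U^\perp\cap\mathfrak V^\perp$. Then $\mathfrak z=\mathfrak U\oplus\mathfrak Z$. Choose a basis $\{u_i\}$ of $\mathfrak U$, the dual basis $\{v_i\}$ of $\mathfrak V$ ($\langle u_i,v_j\rangle=\delta_{ij}$), and orthonormal bases $\{z_\alpha\}$ of $\mathfrak Z$, $\{e_a\}$ of $\mathfrak E$ with $\langle z_\alpha,z_\alpha\rangle=\varepsilon_\alpha=\pm1$, $\langle e_a,e_a\rangle=\bar\varepsilon_a=\pm1$; the linear involution $\iota$ is $\iota u_i=v_i$, $\iota v_i=u_i$, $\iota z_\alpha=\varepsilon_\alpha z_\alpha$, $\iota e_a=\bar\varepsilon_ae_a$. With $\operatorname{ad}^\dagger_x$ the adjoint of $\operatorname{ad}_x$ with respect to $\langle\,,\rangle$, the map $j:\mathfrak U\oplus\mathfrak Z\to\operatorname{End}(\mathfrak V\oplus\mathfrak E)$ is $j(a)x=\iota\operatorname{ad}^\dagger_x(\iota a)$; equivalently $\langle j(a)x,\iota y\rangle=\langle[x,y],\iota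 a\rangle$ for $x,y\in\mathfrak V\oplus\mathfrak E$. *)

theory Defs
  imports "HOL-Analysis.Analysis" "HOL-Library.Function_Algebras"
begin

section \<open>Pointwise vector space structure on functions\<close>

instantiation "fun" :: (type, real_vector) real_vector
begin

definition scaleR_fun :: "real \<Rightarrow> ('a \<Rightarrow> 'b) \<Rightarrow> 'a \<Rightarrow> 'b" where
  "scaleR_fun c f = (\<lambda>x. c *\<^sub>R f x)"

instance
  by standard (auto simp: scaleR_fun_def plus_fun_def scaleR_add_right scaleR_add_left)

end


section \<open>Smooth manifolds\<close>

fun Ck_on :: "nat \<Rightarrow> 'a::euclidean_space set \<Rightarrow> ('a \<Rightarrow> 'b::real_normed_vector) \<Rightarrow> bool" where
  "Ck_on 0 S f \<longleftrightarrow> continuous_on S f"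
| "Ck_on (Suc k) S f \<longleftrightarrow> (\<forall>x\<in>S. f differentiable (at x)) \<and>
     (\<forall>w. Ck_on k S (\<lambda>x. frechet_derivative f (at x) w))"

text \<open>Only used for open \<open>S\<close>.\<close>

definition smooth_on :: "'a::euclidean_space set \<Rightarrow> ('a \<Rightarrow> 'b::real_normed_vector) \<Rightarrow> bool" where
  "smooth_on S f \<longleftrightarrow> (\<forall>k. Ck_on k S f)"

text \<open>A chart is a pair of its domain and a coordinate map into the model space \<open>'e\<close>, whose values
  outside the domain are irrelevant. The manifold is the whole type \<open>'g\<close>; since the type is a
  variable, this is no restriction.\<close>

type_synonym ('g, 'e) chart = "'g set \<times> ('g \<Rightarrow> 'e)"

definition smooth_atlas :: "('g::topological_space, 'e::euclidean_space) chart set \<Rightarrow> bool" where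
  "smooth_atlas A \<longleftrightarrow>
     (\<Union>(U, \<phi>)\<in>A. U) = UNIV \<and>
     (\<forall>(U, \<phi>)\<in>A. open U \<and> open (\<phi> ` U) \<and> homeomorphism U (\<phi> ` U) \<phi> (inv_into U \<phi>)) \<and>
     (\<forall>(U, \<phi>)\<in>A. \<forall>(V, \<psi>)\<in>A. smooth_on (\<phi> ` (U \<inter> V)) (\<psi> \<circ> inv_into U \<phi>))"

definition prod_atlas :: "('g, 'e) chart set \<Rightarrow> ('h, 'f) chart set \<Rightarrow> ('g \<times> 'h, 'e \<times> 'f) chart set" where
  "prod_atlas A B = {(U \<times> V, map_prod \<phi> \<psi>) | U \<phi> V \<psi>. (U, \<phi>) \<in> A \<and> (V, \<psi>) \<in> B}"

definition smooth_map ::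
  "('g::topological_space, 'e::euclidean_space) chart set \<Rightarrow>
   ('h::topological_space, 'f::euclidean_space) chart set \<Rightarrow> ('g \<Rightarrow> 'h) \<Rightarrow> bool" where
  "smooth_map A B f \<longleftrightarrow> continuous_on UNIV f \<and>
     (\<forall>(U, \<phi>)\<in>A. \<forall>(V, \<psi>)\<in>B. smooth_on (\<phi> ` (U \<inter> f -` V)) (\<psi> \<circ> f \<circ> inv_into U \<phi>))"

definition smooth_fun :: "('g, 'e::euclidean_space) chart set \<Rightarrow> ('g \<Rightarrow> real) \<Rightarrow> bool" where
  "smooth_fun A f \<longleftrightarrow> (\<forall>(U, \<phi>)\<in>A. smooth_on (\<phi> ` U) (f \<circ> inv_into U \<phi>))"


section \<open>Tangent vectors and vector fields\<close>

text \<open>Tangent vectors at \<open>p\<close> are the directional derivative operators \<open>f \<mapsto> \<Sum>i. \<xi>\<^sub>i (\<partial>f/\<partial>x\<^sub>i)(p)\<close> on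
  smooth functions, where \<open>x\<close> are the coordinates of a chart around \<open>p\<close>. They are normalised to be
  \<open>0\<close> on functions that are not smooth, so that equality of tangent vectors is equality in HOL.\<close>

type_synonym 'g tangent = "('g \<Rightarrow> real) \<Rightarrow> real"
type_synonym 'g vfield = "'g \<Rightarrow> 'g tangent"

definition coord_vector ::
  "('g, 'e::euclidean_space) chart set \<Rightarrow> ('g, 'e) chart \<Rightarrow> 'g \<Rightarrow> 'e \<Rightarrow> 'g tangent" where
  "coord_vector A c p \<xi> = (\<lambda>f. if smooth_fun A f
     then frechet_derivative (f \<circ> inv_into (fst c) (snd c)) (at (snd c p)) \<xi> else 0)"

definition tangent_space :: "('g, 'e::euclidean_space) chart set \<Rightarrow> 'g \<Rightarrow> 'g tangent set" where
  "tangent_space A p = {coord_vector A c p \<xi> | c \<xi>. c \<in> A \<and> p \<in> fst c}"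

definition vector_fields :: "('g, 'e::euclidean_space) chart set \<Rightarrow> 'g vfield set" where
  "vector_fields A = {X. (\<forall>p. X p \<in> tangent_space A p) \<and>
     (\<forall>f. smooth_fun A f \<longrightarrow> smooth_fun A (\<lambda>p. X p f))}"

text \<open>\<open>[X, Y]f = X(Yf) - Y(Xf)\<close>. The normalisation on non-smooth \<open>f\<close> is automatic.\<close>

definition lie_bracket :: "'g vfield \<Rightarrow> 'g vfield \<Rightarrow> 'g vfield" where
  "lie_bracket X Y = (\<lambda>p f. X p (\<lambda>q. Y q f) - Y p (\<lambda>q. X q f))"


section \<open>Pseudo-Riemannian metrics and the Levi-Civita connection\<close>

definition inner_product_on :: "'a::real_vector set \<Rightarrow> ('a \<Rightarrow> 'a \<Rightarrow> real) \<Rightarrow> bool" where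
  "inner_product_on S b \<longleftrightarrow>
     (\<forall>x\<in>S. \<forall>y\<in>S. b x y = b y x) \<and>
     (\<forall>x\<in>S. \<forall>y\<in>S. \<forall>w\<in>S. b (x + y) w = b x w + b y w) \<and>
     (\<forall>c. \<forall>x\<in>S. \<forall>w\<in>S. b (c *\<^sub>R x) w = c * b x w) \<and>
     (\<forall>x\<in>S. (\<forall>y\<in>S. b x y = 0) \<longrightarrow> x = 0)"

type_synonym 'g metric_tensor = "'g \<Rightarrow> 'g tangent \<Rightarrow> 'g tangent \<Rightarrow> real"

definition pseudo_riemannian ::
  "('g, 'e::euclidean_space) chart set \<Rightarrow> 'g metric_tensor \<Rightarrow> bool" where
  "pseudo_riemannian A g \<longleftrightarrow>
     (\<forall>p. inner_product_on (tangent_space A p) (g p)) \<and>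
     (\<forall>X\<in>vector_fields A. \<forall>Y\<in>vector_fields A. smooth_fun A (\<lambda>p. g p (X p) (Y p)))"

definition levi_civita ::
  "('g, 'e::euclidean_space) chart set \<Rightarrow> 'g metric_tensor \<Rightarrow> ('g vfield \<Rightarrow> 'g vfield \<Rightarrow> 'g vfield) \<Rightarrow> bool"
where
  "levi_civita A g D \<longleftrightarrow>
     (\<forall>X\<in>vector_fields A. \<forall>Y\<in>vector_fields A. D X Y \<in> vector_fields A) \<and>
     (\<forall>X\<in>vector_fields A. \<forall>X'\<in>vector_fields A. \<forall>Y\<in>vector_fields A.
        D (X + X') Y = D X Y + D X' Y) \<and>
     (\<forall>X\<in>vector_fields A. \<forall>Y\<in>vector_fields A. \<forall>f. smooth_fun A f \<longrightarrow>
        D (\<lambda>p. f p *\<^sub>R X p) Y = (\<lambda>p. f p *\<^sub>R D X Y p)) \<and>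
     (\<forall>X\<in>vector_fields A. \<forall>Y\<in>vector_fields A. \<forall>Y'\<in>vector_fields A.
        D X (Y + Y') = D X Y + D X Y') \<and>
     (\<forall>X\<in>vector_fields A. \<forall>Y\<in>vector_fields A. \<forall>f. smooth_fun A f \<longrightarrow>
        D X (\<lambda>p. f p *\<^sub>R Y p) = (\<lambda>p. X p f *\<^sub>R Y p + f p *\<^sub>R D X Y p)) \<and>
     (\<forall>X\<in>vector_fields A. \<forall>Y\<in>vector_fields A. D X Y - D Y X = lie_bracket X Y) \<and>
     (\<forall>X\<in>vector_fields A. \<forall>Y\<in>vector_fields A. \<forall>Z\<in>vector_fields A. \<forall>p.
        X p (\<lambda>q. g q (Y q) (Z q)) = g p (D X Y p) (Z p) + g p (Y p) (D X Z p))"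


section \<open>Lie groups\<close>

text \<open>The class \<^class>\<open>group_add\<close> does not assume commutativity, so groups are written additively here:
  \<open>a + b\<close> is the group product, \<open>- a\<close> the inverse and \<open>0\<close> the identity element.\<close>

definition lie_group ::
  "('g::{topological_group_add, t2_space, second_countable_topology}, 'e::euclidean_space) chart set \<Rightarrow> bool"
where
  "lie_group A \<longleftrightarrow> smooth_atlas A \<and>
     smooth_map (prod_atlas A A) A (\<lambda>(a, b). a + b) \<and> smooth_map A A uminus"

text \<open>The differential of the left translation \<open>q \<mapsto> a + q\<close>.\<close>

definition left_translate :: "'g::group_add \<Rightarrow> 'g tangent \<Rightarrow> 'g tangent" where
  "left_translate a w = (\<lambda>f. w (\<lambda>q. f (a + q)))"

definition lie_algebra :: "('g::group_add, 'e::euclidean_space) chart set \<Rightarrow> 'g vfield set" where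
  "lie_algebra A = {X \<in> vector_fields A. \<forall>a p. X (a + p) = left_translate a (X p)}"

definition left_invariant_metric ::
  "('g::group_add, 'e::euclidean_space) chart set \<Rightarrow> 'g metric_tensor \<Rightarrow> bool" where
  "left_invariant_metric A g \<longleftrightarrow> (\<forall>a p. \<forall>w\<in>tangent_space A p. \<forall>w'\<in>tangent_space A p.
     g (a + p) (left_translate a w) (left_translate a w') = g p w w')"

text \<open>The inner product induced on the Lie algebra; for a left-invariant metric \<open>g p (X p) (Y p)\<close> is
  independent of \<open>p\<close>.\<close>

definition inner_at_identity :: "'g::group_add metric_tensor \<Rightarrow> 'g vfield \<Rightarrow> 'g vfield \<Rightarrow> real" where
  "inner_at_identity g X Y = g 0 (X 0) (Y 0)"


section \<open>Lie algebras with an inner product\<close>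

definition lie_center :: "'g vfield set \<Rightarrow> 'g vfield set" where
  "lie_center L = {X \<in> L. \<forall>Y\<in>L. lie_bracket X Y = 0}"

definition orth :: "'a set \<Rightarrow> ('a \<Rightarrow> 'a \<Rightarrow> real) \<Rightarrow> 'a set \<Rightarrow> 'a set" where
  "orth L b S = {x \<in> L. \<forall>y\<in>S. b x y = 0}"

definition totally_null :: "('a \<Rightarrow> 'a \<Rightarrow> real) \<Rightarrow> 'a set \<Rightarrow> bool" where
  "totally_null b S \<longleftrightarrow> (\<forall>x\<in>S. \<forall>y\<in>S. b x y = 0)"

definition dually_paired :: "('a::zero \<Rightarrow> 'a \<Rightarrow> real) \<Rightarrow> 'a set \<Rightarrow> 'a set \<Rightarrow> bool" where
  "dually_paired b S T \<longleftrightarrow>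
     (\<forall>x\<in>S. (\<forall>y\<in>T. b x y = 0) \<longrightarrow> x = 0) \<and> (\<forall>y\<in>T. (\<forall>x\<in>S. b x y = 0) \<longrightarrow> y = 0)"

definition basis_family :: "nat \<Rightarrow> (nat \<Rightarrow> 'a::real_vector) \<Rightarrow> 'a set \<Rightarrow> bool" where
  "basis_family n w S \<longleftrightarrow>
     inj_on w {..<n} \<and> independent (w ` {..<n}) \<and> span (w ` {..<n}) = S"

definition orthonormal_family ::
  "('a \<Rightarrow> 'a \<Rightarrow> real) \<Rightarrow> nat \<Rightarrow> (nat \<Rightarrow> 'a) \<Rightarrow> (nat \<Rightarrow> real) \<Rightarrow> bool" where
  "orthonormal_family b n w \<epsilon> \<longleftrightarrow> (\<forall>i<n. \<epsilon> i = 1 \<or> \<epsilon> i = - 1) \<and>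
     (\<forall>i<n. \<forall>j<n. b (w i) (w j) = (if i = j then \<epsilon> i else 0))"

definition adjoint_on :: "'a set \<Rightarrow> ('a \<Rightarrow> 'a \<Rightarrow> real) \<Rightarrow> ('a \<Rightarrow> 'a) \<Rightarrow> 'a \<Rightarrow> 'a" where
  "adjoint_on L b T a = (THE c. c \<in> L \<and> (\<forall>y\<in>L. b c y = b a (T y)))"

definition j_map ::
  "'g vfield set \<Rightarrow> ('g vfield \<Rightarrow> 'g vfield \<Rightarrow> real) \<Rightarrow> ('g vfield \<Rightarrow> 'g vfield) \<Rightarrow>
   'g vfield \<Rightarrow> 'g vfield \<Rightarrow> 'g vfield" where
  "j_map L b \<iota> a x = \<iota> (adjoint_on L b (lie_bracket x) (\<iota> a))"

end

theory Submission
  imports Defs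
begin

text \<open>On left-invariant fields \<open>\<langle>Y, W\<rangle>\<close> is constant, so Koszul's formula loses its derivative terms
  and reads \<open>\<nabla>\<^sub>X Y = ([X, Y] - ad\<^sup>\<dagger>\<^sub>Y X - ad\<^sup>\<dagger>\<^sub>X Y) / 2\<close>: it is enough to test against left-invariant \<open>W\<close>,
  because every tangent vector extends to a left-invariant field. All cases follow: \<open>ad\<^sup>\<dagger>\<^sub>X = 0\<close> for
  central \<open>X\<close>; \<open>ad\<^sup>\<dagger>\<^sub>X Y = 0\<close> for \<open>Y \<in> \<UU> \<union> \<EE>\<close>, which is orthogonal to \<open>\<zz> = \<UU> \<oplus> \<ZZ>\<close> and hence to all brackets;
  and \<open>ad\<^sup>\<dagger>\<^sub>X Y = \<iota> j(\<iota> Y) X\<close> because \<open>\<iota>\<close> is an involution.\<close>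

section \<open>Calculus of \<open>C\<^sup>k\<close> maps\<close>

text \<open>The difficulty lies between the algebra and the manifold. A priori \<open>D X Y\<close>
  is only a smooth vector field, and nondegeneracy is given on each tangent space, not on the Lie
  algebra. What bridges the two is the smoothness of the field obtained by left-translating one
  tangent vector: applied to a function, it is a partial derivative of that function composed with
  the multiplication, read in a product chart. Since \<open>Ck_on\<close> iterates derivatives in
  fixed directions, the product and chain rules are first put into that form. A second difficulty is
  that \<open>adjoint_on\<close> is a definite description, which says something only once every
  linear functional on the algebra is represented by exactly one element. The adapted frame supplies
  this element explicitly, by the same coefficient formulas that give the orthogonal decomposition;
  the dimension of the algebra never has to be computed.\<close>

lemma frechet_derivative_cong_open:
  assumes "open S" "x \<in> S" "\<And>y. y \<in> S \<Longrightarrow> f y = g y"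
  shows "frechet_derivative f (at x) = frechet_derivative g (at x)"
proof -
  have "(f has_derivative d) (at x) \<longleftrightarrow> (g has_derivative d) (at x)" for d
    using assms has_derivative_transform_within_open[of f d x UNIV S g]
      has_derivative_transform_within_open[of g d x UNIV S f] by auto
  then show ?thesis unfolding frechet_derivative_def by simp
qed

lemma differentiable_cong_open:
  assumes "open S" "x \<in> S" "\<And>y. y \<in> S \<Longrightarrow> f y = g y" "f differentiable (at x)"
  shows "g differentiable (at x)"
  using assms has_derivative_transform_within_open[of f _ x UNIV S g]
  unfolding differentiable_def by blast

text \<open>Kept out of the simplifier so that exactly one level of \<open>Ck_on\<close> is unfolded
  at a time; otherwise \<open>Suc (Suc k)\<close> would unfold twice and no longer match the
  induction hypotheses.\<close>

lemmas Ck_on_Suc_iff = Ck_on.simps(2)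

declare Ck_on_Suc_iff [simp del]

lemma Ck_on_cong:
  assumes "open S" "\<And>y. y \<in> S \<Longrightarrow> f y = g y" "Ck_on k S f"
  shows "Ck_on k S g"
  using assms(2,3)
proof (induction k arbitrary: f g)
  case 0
  then show ?case by (simp cong: continuous_on_cong)
next
  case (Suc k)
  have *: "frechet_derivative f (at x) = frechet_derivative g (at x)" if "x \<in> S" for x
    using frechet_derivative_cong_open[OF assms(1) that Suc.prems(1)] .
  have "Ck_on k S (\<lambda>x. frechet_derivative g (at x) w)" for w
  proof (rule Suc.IH)
    show "frechet_derivative f (at x) w = frechet_derivative g (at x) w" if "x \<in> S" for x
      by (simp add: * that)
    show "Ck_on k S (\<lambda>x. frechet_derivative f (at x) w)"
      using Suc.prems(2) by (simp add: Ck_on_Suc_iff)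
  qed
  moreover have "g differentiable (at x)" if "x \<in> S" for x
    using differentiable_cong_open[OF assms(1) that Suc.prems(1)] Suc.prems(2) that
    by (simp add: Ck_on_Suc_iff)
  ultimately show ?case by (simp add: Ck_on_Suc_iff)
qed

lemma Ck_on_SucD: "Ck_on (Suc k) S f \<Longrightarrow> Ck_on k S f"
proof (induction k arbitrary: f)
  case 0
  then show ?case
    by (auto intro!: continuous_at_imp_continuous_on differentiable_imp_continuous_within simp: Ck_on_Suc_iff)
next
  case (Suc k)
  have "Ck_on k S (\<lambda>x. frechet_derivative f (at x) w)" for w
    using Suc.prems by (intro Suc.IH) (simp add: Ck_on_Suc_iff[of "Suc k"])
  then show ?case using Suc.prems by (simp add: Ck_on_Suc_iff)
qed

text \<open>The derivatives are full derivatives at a point, so every level is a pointwise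
  condition; this includes level 0, because continuity on the open \<open>T\<close> is continuity at
  each of its points. It allows a different chart of the target around each point.\<close>

lemma Ck_on_local:
  assumes "\<And>x. x \<in> S \<Longrightarrow> \<exists>T. open T \<and> x \<in> T \<and> Ck_on k T f"
  shows "Ck_on k S f"
  using assms
proof (induction k arbitrary: f)
  case 0
  then show ?case
    by (force intro!: continuous_at_imp_continuous_on simp: continuous_on_eq_continuous_at)
next
  case (Suc k)
  have "Ck_on k S (\<lambda>x. frechet_derivative f (at x) w)" for w
    using Suc.prems by (intro Suc.IH) (fastforce simp: Ck_on_Suc_iff)
  moreover have "\<forall>x\<in>S. f differentiable (at x)"
    using Suc.prems by (fastforce simp: Ck_on_Suc_iff)
  ultimately show ?case by (simp add: Ck_on_Suc_iff)
qed

lemma Ck_on_const: "Ck_on k S (\<lambda>x. c)"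
  by (induction k arbitrary: c) (auto simp: Ck_on_Suc_iff)

lemma Ck_on_add:
  assumes "Ck_on k S f" "Ck_on k S g" "open S"
  shows "Ck_on k S (\<lambda>x. f x + g x)"
  using assms(1,2)
proof (induction k arbitrary: f g)
  case 0
  then show ?case by (auto intro: continuous_intros)
next
  case (Suc k)
  have d: "((\<lambda>x. f x + g x) has_derivative
      (\<lambda>w. frechet_derivative f (at x) w + frechet_derivative g (at x) w)) (at x)"
    if "x \<in> S" for x
    using Suc.prems that
    by (intro has_derivative_add) (simp_all add: frechet_derivative_works[symmetric] Ck_on_Suc_iff)
  have "Ck_on k S (\<lambda>x. frechet_derivative (\<lambda>x. f x + g x) (at x) w)" for w
    by (rule Ck_on_cong[OF assms(3) _ Suc.IH,
        of "\<lambda>x. frechet_derivative f (at x) w" "\<lambda>x. frechet_derivative g (at x) w"])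
      (use Suc.prems frechet_derivative_at[OF d] in \<open>auto dest: fun_cong simp: Ck_on_Suc_iff\<close>)
  then show ?case using d by (auto simp: differentiable_def Ck_on_Suc_iff)
qed

lemma Ck_on_sum:
  assumes "\<And>i. i \<in> I \<Longrightarrow> Ck_on k S (f i)" "open S"
  shows "Ck_on k S (\<lambda>x. \<Sum>i\<in>I. f i x)"
  using assms
proof (induction I rule: infinite_finite_induct)
  case (insert i I)
  then show ?case by (simp add: Ck_on_add)
qed (simp_all add: Ck_on_const)

lemma Ck_on_bounded_linear:
  assumes "bounded_linear h" "open S" "Ck_on k S f"
  shows "Ck_on k S (\<lambda>x. h (f x))"
  using assms(3)
proof (induction k arbitrary: f)
  case 0
  then show ?case
    by (auto intro!: bounded_linear.continuous_on[OF assms(1)])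
next
  case (Suc k)
  have d: "((\<lambda>x. h (f x)) has_derivative (\<lambda>w. h (frechet_derivative f (at x) w))) (at x)"
    if "x \<in> S" for x
    using Suc.prems that
    by (intro bounded_linear.has_derivative[OF assms(1)]) (simp add: frechet_derivative_works[symmetric] Ck_on_Suc_iff)
  have "Ck_on k S (\<lambda>x. frechet_derivative (\<lambda>x. h (f x)) (at x) w)" for w
    by (rule Ck_on_cong[OF assms(2) _ Suc.IH[of "\<lambda>x. frechet_derivative f (at x) w"]])
      (use Suc.prems frechet_derivative_at[OF d] in \<open>auto dest: fun_cong simp: Ck_on_Suc_iff\<close>)
  then show ?case using d by (auto simp: differentiable_def Ck_on_Suc_iff)
qed

text \<open>By Leibniz, a directional derivative is a sum of two products, each pairing a derivative
  with one of the original functions. The latter enter the induction hypothesis one degree lower,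
  hence the appeal to \<open>Ck_on_SucD\<close>.\<close>

lemma Ck_on_scaleR:
  assumes "Ck_on k S f" "Ck_on k S g" "open S"
  shows "Ck_on k S (\<lambda>x. f x *\<^sub>R g x)"
  using assms(1,2)
proof (induction k arbitrary: f g)
  case 0
  then show ?case by (auto intro: continuous_intros)
next
  case (Suc k)
  have d: "((\<lambda>x. f x *\<^sub>R g x) has_derivative
      (\<lambda>w. f x *\<^sub>R frechet_derivative g (at x) w + frechet_derivative f (at x) w *\<^sub>R g x)) (at x)"
    if "x \<in> S" for x
    using Suc.prems that
    by (intro has_derivative_scaleR) (simp_all add: frechet_derivative_works[symmetric] Ck_on_Suc_iff)
  have "Ck_on k S (\<lambda>x. frechet_derivative (\<lambda>x. f x *\<^sub>R g x) (at x) w)" for w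
    by (rule Ck_on_cong[OF assms(3) _ Ck_on_add[OF Suc.IH Suc.IH assms(3)],
        of f "\<lambda>x. frechet_derivative g (at x) w" "\<lambda>x. frechet_derivative f (at x) w" g])
      (use Suc.prems[THEN Ck_on_SucD] Suc.prems frechet_derivative_at[OF d] in \<open>auto dest: fun_cong simp: Ck_on_Suc_iff\<close>)
  then show ?case using d by (auto simp: differentiable_def Ck_on_Suc_iff)
qed

text \<open>The chain rule differentiates \<open>g\<close> in the direction \<open>Df(x) w\<close>,
  which moves with \<open>x\<close>, whereas \<open>Ck_on\<close> controls fixed directions only.
  Expanding that direction in \<open>Basis\<close> leaves products of coordinates of
  \<open>Df(x) w\<close> with fixed-direction derivatives of \<open>g\<close> composed with
  \<open>f\<close>. So the induction changes \<open>g\<close> and keeps \<open>f\<close>.\<close>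

lemma Ck_on_compose:
  fixes f :: "'a::euclidean_space \<Rightarrow> 'b::euclidean_space"
  assumes "open S" "open T" "f ` S \<subseteq> T" "Ck_on k T g" "Ck_on k S f"
  shows "Ck_on k S (\<lambda>x. g (f x))"
  using assms(3-5)
proof (induction k arbitrary: g)
  case 0
  then show ?case by (auto intro: continuous_on_compose2)
next
  case (Suc k)
  have d: "((\<lambda>x. g (f x)) has_derivative
      (\<lambda>w. frechet_derivative g (at (f x)) (frechet_derivative f (at x) w))) (at x)"
    if "x \<in> S" for x
    using Suc.prems that
    by (intro has_derivative_compose[of f _ x UNIV g]) (auto simp: frechet_derivative_works[symmetric] Ck_on_Suc_iff)
  have eq: "frechet_derivative (\<lambda>x. g (f x)) (at x) w =
      (\<Sum>b\<in>Basis. (frechet_derivative f (at x) w \<bullet> b) *\<^sub>R frechet_derivative g (at (f x)) b)"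
    if "x \<in> S" for x w
  proof -
    have "linear (frechet_derivative g (at (f x)))"
      using Suc.prems that by (intro linear_frechet_derivative) (auto simp: Ck_on_Suc_iff)
    then have "frechet_derivative g (at (f x)) v =
        (\<Sum>b\<in>Basis. (v \<bullet> b) *\<^sub>R frechet_derivative g (at (f x)) b)" for v
      by (subst euclidean_representation[of v, symmetric]) (simp add: linear_sum linear_scale)
    then show ?thesis using frechet_derivative_at[OF d[OF that]] by metis
  qed
  have "Ck_on k S (\<lambda>x. \<Sum>b\<in>Basis. (frechet_derivative f (at x) w \<bullet> b) *\<^sub>R frechet_derivative g (at (f x)) b)" for w
    using Suc.prems Ck_on_SucD[OF Suc.prems(3)]
    by (intro Ck_on_sum Ck_on_scaleR assms(1) Suc.IH[of "\<lambda>y. frechet_derivative g (at y) _"]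
        Ck_on_bounded_linear[OF bounded_linear_inner_left]) (auto simp: Ck_on_Suc_iff)
  then have "Ck_on k S (\<lambda>x. frechet_derivative (\<lambda>x. g (f x)) (at x) w)" for w
    by (rule Ck_on_cong[OF assms(1), rotated]) (simp add: eq)
  then show ?case using d by (auto simp: differentiable_def Ck_on_Suc_iff)
qed

text \<open>The same \<open>h\<close> is the derivative everywhere, so all directional derivatives
  are constants and a case split on \<open>k\<close> replaces induction.\<close>

lemma Ck_on_affine:
  assumes "\<And>x. (f has_derivative h) (at x)"
  shows "Ck_on k S f"
proof (cases k)
  case 0
  then show ?thesis
    using assms by (auto intro!: continuous_at_imp_continuous_on has_derivative_continuous)
next
  case (Suc n)
  have "frechet_derivative f (at x) = h" for x
    using frechet_derivative_at[OF assms] by simp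
  then show ?thesis using Suc assms by (auto simp: Ck_on_const differentiable_def Ck_on_Suc_iff)
qed

section \<open>Smoothness of all orders\<close>

lemma smooth_on_cong:
  "open S \<Longrightarrow> (\<And>y. y \<in> S \<Longrightarrow> f y = g y) \<Longrightarrow> smooth_on S f \<Longrightarrow> smooth_on S g"
  unfolding smooth_on_def using Ck_on_cong by blast

lemma smooth_on_compose:
  fixes f :: "'a::euclidean_space \<Rightarrow> 'b::euclidean_space"
  shows "open S \<Longrightarrow> open T \<Longrightarrow> f ` S \<subseteq> T \<Longrightarrow> smooth_on T g \<Longrightarrow> smooth_on S f \<Longrightarrow> smooth_on S (\<lambda>x. g (f x))"
  unfolding smooth_on_def using Ck_on_compose by blast

lemma smooth_on_frechet_derivative:
  "smooth_on S f \<Longrightarrow> smooth_on S (\<lambda>x. frechet_derivative f (at x) w)"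
  unfolding smooth_on_def by (metis Ck_on_Suc_iff)

lemma smooth_on_differentiable: "smooth_on S f \<Longrightarrow> x \<in> S \<Longrightarrow> f differentiable (at x)"
  unfolding smooth_on_def by (metis Ck_on_Suc_iff)

text \<open>Slice inclusions: composing with them freezes one factor of the group product in
  coordinates.\<close>

lemma smooth_on_Pair_left: "smooth_on S (\<lambda>x. (c, x))"
  unfolding smooth_on_def
  by (intro allI Ck_on_affine[where h = "\<lambda>w. (0, w)"]) (auto intro!: derivative_eq_intros)

lemma smooth_on_Pair_right: "smooth_on S (\<lambda>x. (x, c))"
  unfolding smooth_on_def
  by (intro allI Ck_on_affine[where h = "\<lambda>w. (w, 0)"]) (auto intro!: derivative_eq_intros)

section \<open>Smooth maps and tangent vectors\<close>

lemma smooth_on_local: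
  "(\<And>x. x \<in> S \<Longrightarrow> \<exists>T. open T \<and> x \<in> T \<and> smooth_on T f) \<Longrightarrow> smooth_on S f"
  unfolding smooth_on_def by (meson Ck_on_local)

lemma smooth_on_const: "smooth_on S (\<lambda>x. c)"
  by (simp add: smooth_on_def Ck_on_const)

text \<open>Collects the properties of the charts of \<open>A\<close> that pass directly to the
  charts of \<open>prod_atlas A A\<close>, so that one set of lemmas serves both.\<close>

definition open_chart :: "'g::topological_space set \<Rightarrow> ('g \<Rightarrow> 'e::topological_space) \<Rightarrow> bool" where
  "open_chart U \<phi> \<longleftrightarrow> open U \<and> inj_on \<phi> U \<and> (\<forall>W. open W \<longrightarrow> open (\<phi> ` (U \<inter> W)))"

lemma open_chartD:
  assumes "open_chart U \<phi>"
  shows "open U" "inj_on \<phi> U" "open W \<Longrightarrow> open (\<phi> ` (U \<inter> W))" "open (\<phi> ` U)"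
  using assms unfolding open_chart_def by (auto dest: spec[of _ UNIV])

lemma open_chart_inv [simp]: "open_chart U \<phi> \<Longrightarrow> p \<in> U \<Longrightarrow> inv_into U \<phi> (\<phi> p) = p"
  by (simp add: open_chart_def)

text \<open>Boxes \<open>P \<times> Q\<close> form a basis of the product topology, and
  \<open>map_prod\<close> sends boxes to boxes.\<close>

lemma open_chart_prod:
  assumes "open_chart U \<phi>" "open_chart V \<psi>"
  shows "open_chart (U \<times> V) (map_prod \<phi> \<psi>)"
  unfolding open_chart_def
proof (intro conjI allI impI)
  show "open (U \<times> V)"
    using assms by (simp add: open_chart_def open_Times)
  show "inj_on (map_prod \<phi> \<psi>) (U \<times> V)"
    using assms by (simp add: open_chart_def map_prod_inj_on)
  fix W :: "('a \<times> 'c) set"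
  assume W: "open W"
  show "open (map_prod \<phi> \<psi> ` (U \<times> V \<inter> W))"
  proof (subst open_subopen, intro ballI)
    fix y
    assume "y \<in> map_prod \<phi> \<psi> ` (U \<times> V \<inter> W)"
    then obtain a b where ab: "a \<in> U" "b \<in> V" "(a, b) \<in> W" "y = (\<phi> a, \<psi> b)" by auto
    obtain P Q where PQ: "open P" "open Q" "(a, b) \<in> P \<times> Q" "P \<times> Q \<subseteq> W"
      using open_prod_elim[OF W ab(3)] by blast
    let ?T = "\<phi> ` (U \<inter> P) \<times> \<psi> ` (V \<inter> Q)"
    have "open ?T" using assms PQ by (simp add: open_chart_def open_Times)
    moreover have "y \<in> ?T" using ab PQ by auto
    moreover have "?T \<subseteq> map_prod \<phi> \<psi> ` (U \<times> V \<inter> W)" using PQ by force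
    ultimately show "\<exists>T. open T \<and> y \<in> T \<and> T \<subseteq> map_prod \<phi> \<psi> ` (U \<times> V \<inter> W)" by blast
  qed
qed

lemma smooth_atlas_open_chart:
  assumes "smooth_atlas A" "(U, \<phi>) \<in> A"
  shows "open_chart U \<phi>"
proof -
  have o: "open U" "open (\<phi> ` U)" and h: "homeomorphism U (\<phi> ` U) \<phi> (inv_into U \<phi>)"
    using assms unfolding smooth_atlas_def by auto
  have "inj_on \<phi> U"
    using h by (metis homeomorphism_apply1 inj_on_inverseI)
  moreover have "open (\<phi> ` (U \<inter> W))" if "open W" for W
    using homeomorphism_imp_open_map[OF h, of "U \<inter> W"] o that
    by (simp add: openin_open_eq open_Int)
  ultimately show ?thesis using o by (simp add: open_chart_def)
qed

lemma smooth_atlas_cover: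
  assumes "smooth_atlas A"
  obtains U \<phi> where "(U, \<phi>) \<in> A" "p \<in> U"
proof -
  have "p \<in> (\<Union>(U, \<phi>)\<in>A. U)" using assms unfolding smooth_atlas_def by simp
  then show thesis using that by auto
qed

text \<open>For the identity, smoothness is exactly the compatibility of charts. A change of chart
  thereby becomes an instance of pushing vectors along a smooth map.\<close>

lemma smooth_map_id:
  "smooth_atlas A \<Longrightarrow> smooth_map A A (\<lambda>p. p)"
  unfolding smooth_atlas_def smooth_map_def by (auto simp: comp_def)

lemma smooth_mapD:
  "smooth_map A B h \<Longrightarrow> (U, \<phi>) \<in> A \<Longrightarrow> (V, \<psi>) \<in> B \<Longrightarrow>
    smooth_on (\<phi> ` (U \<inter> h -` V)) (\<lambda>y. \<psi> (h (inv_into U \<phi> y)))"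
  unfolding smooth_map_def by (force simp: comp_def)

lemma smooth_map_open_vimage: "smooth_map A B h \<Longrightarrow> open V \<Longrightarrow> open (h -` V)"
  unfolding smooth_map_def by (simp add: continuous_on_open_vimage)

lemma smooth_funD:
  "smooth_fun A f \<Longrightarrow> (U, \<phi>) \<in> A \<Longrightarrow> smooth_on (\<phi> ` U) (\<lambda>y. f (inv_into U \<phi> y))"
  unfolding smooth_fun_def by (force simp: comp_def)

lemma smooth_funI:
  "(\<And>U \<phi>. (U, \<phi>) \<in> A \<Longrightarrow> smooth_on (\<phi> ` U) (\<lambda>y. f (inv_into U \<phi> y))) \<Longrightarrow> smooth_fun A f"
  unfolding smooth_fun_def by (auto simp: comp_def)

lemma smooth_fun_const: "smooth_fun A (\<lambda>p. c)"
  by (intro smooth_funI smooth_on_const)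

lemma smooth_fun_add:
  assumes "smooth_atlas A" "smooth_fun A f" "smooth_fun A f'"
  shows "smooth_fun A (\<lambda>p. f p + f' p)"
proof (rule smooth_funI)
  fix U \<phi>
  assume U: "(U, \<phi>) \<in> A"
  show "smooth_on (\<phi> ` U) (\<lambda>y. f (inv_into U \<phi> y) + f' (inv_into U \<phi> y))"
    using smooth_funD[OF assms(2) U] smooth_funD[OF assms(3) U]
      open_chartD(4)[OF smooth_atlas_open_chart[OF assms(1) U]]
    by (simp add: smooth_on_def Ck_on_add)
qed

lemma smooth_fun_scale:
  assumes "smooth_atlas A" "smooth_fun A f"
  shows "smooth_fun A (\<lambda>p. c * f p)"
proof (rule smooth_funI)
  fix U \<phi>
  assume U: "(U, \<phi>) \<in> A"
  show "smooth_on (\<phi> ` U) (\<lambda>y. c * f (inv_into U \<phi> y))"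
    using smooth_funD[OF assms(2) U] open_chartD(4)[OF smooth_atlas_open_chart[OF assms(1) U]]
    by (simp add: smooth_on_def Ck_on_bounded_linear[OF bounded_linear_mult_right])
qed

text \<open>A chart domain of the source may not map into a single chart of the target. Around each
  point \<open>f\<close> is therefore factored through a chart at the image point, on the part of
  \<open>U\<close> that lands in it. The source is any family of open charts, so that group
  multiplication on \<open>prod_atlas A A\<close> is covered.\<close>

lemma smooth_fun_compose:
  fixes P :: "('p::topological_space, 'a::euclidean_space) chart set"
    and B :: "('g::topological_space, 'e::euclidean_space) chart set"
  assumes P: "\<And>U \<phi>. (U, \<phi>) \<in> P \<Longrightarrow> open_chart U \<phi>"
    and B: "smooth_atlas B" and h: "smooth_map P B h" and f: "smooth_fun B f"
  shows "smooth_fun P (\<lambda>p. f (h p))"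
proof (rule smooth_funI, rule smooth_on_local)
  fix U \<phi> y
  assume U: "(U, \<phi>) \<in> P" and y: "y \<in> \<phi> ` U"
  then obtain p where p: "p \<in> U" "y = \<phi> p" by auto
  obtain V \<psi> where V: "(V, \<psi>) \<in> B" "h p \<in> V" by (rule smooth_atlas_cover[OF B])
  note cU = P[OF U] and cV = smooth_atlas_open_chart[OF B V(1)]
  let ?T = "\<phi> ` (U \<inter> h -` V)"
  have T: "open ?T"
    by (rule open_chartD(3)[OF cU smooth_map_open_vimage[OF h open_chartD(1)[OF cV]]])
  have "smooth_on ?T (\<lambda>y. f (inv_into V \<psi> (\<psi> (h (inv_into U \<phi> y)))))"
    by (rule smooth_on_compose[OF T open_chartD(4)[OF cV] _ smooth_funD[OF f V(1)] smooth_mapD[OF h U V(1)]])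
      (use cU in auto)
  then have "smooth_on ?T (\<lambda>y. f (h (inv_into U \<phi> y)))"
    by (rule smooth_on_cong[OF T, rotated]) (use cU cV in auto)
  then show "\<exists>T. open T \<and> y \<in> T \<and> smooth_on T (\<lambda>y. f (h (inv_into U \<phi> y)))"
    using T p V by blast
qed

text \<open>The chain rule for the differential of \<open>h\<close> in coordinates. The identity
  gives the change of coordinates of a tangent vector, and a left translation gives its left
  translate.\<close>

lemma coord_vector_push:
  fixes A :: "('g::topological_space, 'e::euclidean_space) chart set"
    and B :: "('h::topological_space, 'a::euclidean_space) chart set"
  assumes A: "smooth_atlas A" and B: "smooth_atlas B" and h: "smooth_map A B h"
    and U: "(U, \<phi>) \<in> A" "p \<in> U" and V: "(V, \<psi>) \<in> B" "h p \<in> V" and f: "smooth_fun B f"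
  shows "coord_vector A (U, \<phi>) p \<xi> (\<lambda>q. f (h q)) =
    coord_vector B (V, \<psi>) (h p) (frechet_derivative (\<lambda>y. \<psi> (h (inv_into U \<phi> y))) (at (\<phi> p)) \<xi>) f"
proof -
  note cU = smooth_atlas_open_chart[OF A U(1)] and cV = smooth_atlas_open_chart[OF B V(1)]
  let ?T = "\<phi> ` (U \<inter> h -` V)" and ?k = "\<lambda>y. \<psi> (h (inv_into U \<phi> y))"
  have T: "open ?T" "\<phi> p \<in> ?T"
    using open_chartD(3)[OF cU smooth_map_open_vimage[OF h open_chartD(1)[OF cV]]] U V by auto
  have k: "(?k has_derivative frechet_derivative ?k (at (\<phi> p))) (at (\<phi> p))"
    using smooth_on_differentiable[OF smooth_mapD[OF h U(1) V(1)] T(2)]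
    by (simp add: frechet_derivative_works[symmetric])
  have kp: "?k (\<phi> p) = \<psi> (h p)" using cU U by simp
  let ?f = "\<lambda>y. f (inv_into V \<psi> y)"
  have "(?f has_derivative frechet_derivative ?f (at (\<psi> (h p)))) (at (?k (\<phi> p)))"
    using smooth_on_differentiable[OF smooth_funD[OF f V(1)], of "\<psi> (h p)"] V kp
    by (simp add: frechet_derivative_works[symmetric])
  from has_derivative_compose[OF k this]
  have "((\<lambda>y. f (h (inv_into U \<phi> y))) has_derivative
      (\<lambda>\<xi>. frechet_derivative ?f (at (\<psi> (h p))) (frechet_derivative ?k (at (\<phi> p)) \<xi>))) (at (\<phi> p))"
    by (rule has_derivative_transform_within_open[OF _ T]) (use cU cV in auto)
  from fun_cong[OF frechet_derivative_at[OF this], of \<xi>] show ?thesis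
    using f smooth_fun_compose[OF smooth_atlas_open_chart[OF A] B h f]
    by (simp add: coord_vector_def comp_def)
qed

section \<open>Tangent spaces as vector spaces of operators\<close>

lemma coord_vector_apply:
  "smooth_fun A f \<Longrightarrow> coord_vector A (U, \<phi>) p \<xi> f =
    frechet_derivative (\<lambda>y. f (inv_into U \<phi> y)) (at (\<phi> p)) \<xi>"
  by (simp add: coord_vector_def comp_def)

lemma coord_vector_nonsmooth [simp]: "\<not> smooth_fun A f \<Longrightarrow> coord_vector A c p \<xi> f = 0"
  by (simp add: coord_vector_def)

lemma smooth_fun_differentiable:
  assumes "smooth_fun A f" "(U, \<phi>) \<in> A" "p \<in> U"
  shows "(\<lambda>y. f (inv_into U \<phi> y)) differentiable (at (\<phi> p))"
  using smooth_on_differentiable[OF smooth_funD[OF assms(1,2)]] assms(3) by blast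

lemma linear_coord_vector:
  assumes "(U, \<phi>) \<in> A" "p \<in> U"
  shows "linear (coord_vector A (U, \<phi>) p)"
proof (rule linearI; rule ext)
  fix x y :: 'b and c :: real and f
  show "coord_vector A (U, \<phi>) p (x + y) f = (coord_vector A (U, \<phi>) p x + coord_vector A (U, \<phi>) p y) f"
    using linear_frechet_derivative[OF smooth_fun_differentiable[OF _ assms], of f]
    by (cases "smooth_fun A f") (simp_all add: coord_vector_apply linear_add)
  show "coord_vector A (U, \<phi>) p (c *\<^sub>R x) f = (c *\<^sub>R coord_vector A (U, \<phi>) p x) f"
    using linear_frechet_derivative[OF smooth_fun_differentiable[OF _ assms], of f]
    by (cases "smooth_fun A f") (simp_all add: coord_vector_apply linear_scale scaleR_fun_def)
qed

text \<open>Pushing along the identity moves a vector from any chart at \<open>p\<close> to the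
  chosen one. The tangent space is thus a linear image of the model space, hence a subspace.\<close>

lemma tangent_space_eq_range:
  assumes A: "smooth_atlas A" and V: "(V, \<psi>) \<in> A" "p \<in> V"
  shows "tangent_space A p = range (coord_vector A (V, \<psi>) p)"
proof
  show "tangent_space A p \<subseteq> range (coord_vector A (V, \<psi>) p)"
  proof
    fix w
    assume "w \<in> tangent_space A p"
    then obtain U \<phi> \<xi> where U: "(U, \<phi>) \<in> A" "p \<in> U" and w: "w = coord_vector A (U, \<phi>) p \<xi>"
      unfolding tangent_space_def by auto
    have "w f = coord_vector A (V, \<psi>) p (frechet_derivative (\<lambda>y. \<psi> (inv_into U \<phi> y)) (at (\<phi> p)) \<xi>) f" for f
      by (cases "smooth_fun A f")
        (simp_all add: w coord_vector_push[OF A A smooth_map_id[OF A] U V])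
    then show "w \<in> range (coord_vector A (V, \<psi>) p)" by blast
  qed
  show "range (coord_vector A (V, \<psi>) p) \<subseteq> tangent_space A p"
    using V unfolding tangent_space_def by force
qed

lemma subspace_tangent_space: "smooth_atlas A \<Longrightarrow> subspace (tangent_space A p)"
  by (metis smooth_atlas_cover tangent_space_eq_range linear_coord_vector linear_subspace_image subspace_UNIV)

text \<open>Restricted to smooth arguments: a tangent vector is 0 on all others, so additivity can
  fail when two non-smooth functions have a smooth sum.\<close>

lemma tangent_add:
  assumes "smooth_atlas A" "w \<in> tangent_space A p" "smooth_fun A f" "smooth_fun A f'"
  shows "w (\<lambda>q. f q + f' q) = w f + w f'"
proof -
  obtain U \<phi> \<xi> where U: "(U, \<phi>) \<in> A" "p \<in> U" and w: "w = coord_vector A (U, \<phi>) p \<xi>"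
    using assms(2) unfolding tangent_space_def by auto
  have "((\<lambda>y. f (inv_into U \<phi> y) + f' (inv_into U \<phi> y)) has_derivative
     (\<lambda>\<xi>. frechet_derivative (\<lambda>y. f (inv_into U \<phi> y)) (at (\<phi> p)) \<xi> +
        frechet_derivative (\<lambda>y. f' (inv_into U \<phi> y)) (at (\<phi> p)) \<xi>)) (at (\<phi> p))"
    using assms U
    by (intro has_derivative_add) (simp_all add: frechet_derivative_works[symmetric] smooth_fun_differentiable)
  from fun_cong[OF frechet_derivative_at[OF this], of \<xi>] show ?thesis
    using assms by (simp add: w coord_vector_apply smooth_fun_add)
qed

lemma tangent_scale:
  assumes "smooth_atlas A" "w \<in> tangent_space A p" "smooth_fun A f"
  shows "w (\<lambda>q. c * f q) = c * w f"
proof -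
  obtain U \<phi> \<xi> where U: "(U, \<phi>) \<in> A" "p \<in> U" and w: "w = coord_vector A (U, \<phi>) p \<xi>"
    using assms(2) unfolding tangent_space_def by auto
  have "((\<lambda>y. c * f (inv_into U \<phi> y)) has_derivative
     (\<lambda>\<xi>. c * frechet_derivative (\<lambda>y. f (inv_into U \<phi> y)) (at (\<phi> p)) \<xi>)) (at (\<phi> p))"
    using assms U
    by (intro has_derivative_mult_right) (simp_all add: frechet_derivative_works[symmetric] smooth_fun_differentiable)
  from fun_cong[OF frechet_derivative_at[OF this], of \<xi>] show ?thesis
    using assms by (simp add: w coord_vector_apply smooth_fun_scale)
qed

lemma tangent_const: "w \<in> tangent_space A p \<Longrightarrow> w (\<lambda>q. c) = 0"
  unfolding tangent_space_def by (auto simp: coord_vector_apply smooth_fun_const)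

lemma tangent_nonsmooth: "w \<in> tangent_space A p \<Longrightarrow> \<not> smooth_fun A f \<Longrightarrow> w f = 0"
  unfolding tangent_space_def by auto

section \<open>Vector fields and linearity of the Lie bracket\<close>

lemma subspace_vector_fields:
  assumes A: "smooth_atlas A"
  shows "subspace (vector_fields A)"
proof (rule subspaceI)
  show "0 \<in> vector_fields A"
    using subspace_0[OF subspace_tangent_space[OF A]]
    by (auto simp: vector_fields_def smooth_fun_const)
next
  fix X Y assume "X \<in> vector_fields A" "Y \<in> vector_fields A"
  then show "X + Y \<in> vector_fields A"
    using subspace_add[OF subspace_tangent_space[OF A]] smooth_fun_add[OF A]
    by (auto simp: vector_fields_def)
next
  fix c :: real and X assume X: "X \<in> vector_fields A"
  have "(c *\<^sub>R X) p = c *\<^sub>R X p" "(c *\<^sub>R X p) f = c * X p f" for p f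
    by (simp_all add: scaleR_fun_def)
  with X show "c *\<^sub>R X \<in> vector_fields A"
    using subspace_scale[OF subspace_tangent_space[OF A]] smooth_fun_scale[OF A]
    by (auto simp: vector_fields_def)
qed

lemma subspace_lie_algebra:
  assumes A: "smooth_atlas A"
  shows "subspace (lie_algebra A)"
proof (rule subspaceI)
  show "0 \<in> lie_algebra A"
    using subspace_0[OF subspace_vector_fields[OF A]]
    by (auto simp: lie_algebra_def left_translate_def)
next
  fix X Y assume "X \<in> lie_algebra A" "Y \<in> lie_algebra A"
  then show "X + Y \<in> lie_algebra A"
    using subspace_add[OF subspace_vector_fields[OF A], of X Y]
    by (auto simp: lie_algebra_def left_translate_def)
next
  fix c X assume "X \<in> lie_algebra A"
  then show "c *\<^sub>R X \<in> lie_algebra A"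
    using subspace_scale[OF subspace_vector_fields[OF A], of X c]
    by (auto simp: lie_algebra_def left_translate_def scaleR_fun_def)
qed

lemma lie_bracket_skew: "lie_bracket Y X = - lie_bracket X Y"
  by (simp add: lie_bracket_def fun_eq_iff)

text \<open>On a non-smooth \<open>f\<close> the normalisation makes the function constantly 0. The
  bracket laws can therefore be proved for all \<open>f\<close> at once.\<close>

lemma vector_field_apply_smooth:
  assumes "X \<in> vector_fields A"
  shows "smooth_fun A (\<lambda>p. X p f)"
proof (cases "smooth_fun A f")
  case False
  then have "X p f = 0" for p
    using assms tangent_nonsmooth[of "X p" A p f] by (simp add: vector_fields_def)
  then show ?thesis by (simp add: smooth_fun_const)
qed (use assms in \<open>simp add: vector_fields_def\<close>)

lemma lie_bracket_add_right:
  assumes "smooth_atlas A" "X \<in> vector_fields A" "Y \<in> vector_fields A" "Y' \<in> vector_fields A"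
  shows "lie_bracket X (Y + Y') = lie_bracket X Y + lie_bracket X Y'"
proof (intro ext)
  fix p f
  have "X p \<in> tangent_space A p" using assms by (simp add: vector_fields_def)
  from tangent_add[OF assms(1) this, of "\<lambda>q. Y q f" "\<lambda>q. Y' q f"]
  show "lie_bracket X (Y + Y') p f = (lie_bracket X Y + lie_bracket X Y') p f"
    using assms by (simp add: lie_bracket_def vector_field_apply_smooth)
qed

lemma lie_bracket_scale_right:
  assumes "smooth_atlas A" "X \<in> vector_fields A" "Y \<in> vector_fields A"
  shows "lie_bracket X (c *\<^sub>R Y) = c *\<^sub>R lie_bracket X Y"
proof (intro ext)
  fix p f
  have "X p \<in> tangent_space A p" using assms by (simp add: vector_fields_def)
  from tangent_scale[OF assms(1) this, of "\<lambda>q. Y q f" c]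
  show "lie_bracket X (c *\<^sub>R Y) p f = (c *\<^sub>R lie_bracket X Y) p f"
    using assms by (simp add: lie_bracket_def vector_field_apply_smooth scaleR_fun_def right_diff_distrib)
qed

section \<open>Left-invariant vector fields\<close>

text \<open>In charts, translation by \<open>b\<close> is the multiplication restricted to the slice
  through the coordinates of \<open>b\<close>.\<close>

lemma smooth_map_left_translation:
  fixes A :: "('g::{topological_group_add, t2_space, second_countable_topology}, 'e::euclidean_space) chart set"
  assumes lie: "lie_group A"
  shows "smooth_map A A ((+) b)"
  unfolding smooth_map_def
proof (intro conjI ballI, safe)
  have A: "smooth_atlas A" and mult: "smooth_map (prod_atlas A A) A (\<lambda>(a, b). a + b)"
    using lie by (auto simp: lie_group_def)
  show "continuous_on UNIV ((+) b)" by (intro continuous_intros)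
  fix U \<phi> V \<psi>
  assume U: "(U, \<phi>) \<in> A" and V: "(V, \<psi>) \<in> A"
  obtain U' \<phi>' where U': "(U', \<phi>') \<in> A" "b \<in> U'" by (rule smooth_atlas_cover[OF A])
  note c = smooth_atlas_open_chart[OF A U] smooth_atlas_open_chart[OF A V]
    smooth_atlas_open_chart[OF A U'(1)]
  note cp = open_chart_prod[OF c(3) c(1)]
  let ?\<Phi> = "map_prod \<phi>' \<phi>" and ?W = "(\<lambda>(a, b). a + b) -` V"
  have UW: "(U' \<times> U, ?\<Phi>) \<in> prod_atlas A A"
    using U U' unfolding prod_atlas_def by blast
  have oW: "open (?\<Phi> ` (U' \<times> U \<inter> ?W))"
    by (intro open_chartD(3)[OF cp] smooth_map_open_vimage[OF mult] open_chartD(1)[OF c(2)])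
  have "open ((+) b -` V)"
    using open_chartD(1)[OF c(2)] by (auto intro!: open_vimage continuous_intros)
  note oT = open_chartD(3)[OF c(1) this]
  have inv: "inv_into (U' \<times> U) ?\<Phi> (\<phi>' b, \<phi> q) = (b, q)" if "q \<in> U" for q
    using open_chart_inv[OF cp, of "(b, q)"] that U' by simp
  have "smooth_on (\<phi> ` (U \<inter> (+) b -` V))
      (\<lambda>y. \<psi> ((\<lambda>(a, b). a + b) (inv_into (U' \<times> U) ?\<Phi> (\<phi>' b, y))))"
    by (rule smooth_on_compose[OF oT oW _ smooth_mapD[OF mult UW V] smooth_on_Pair_left])
      (use U' in force)
  then show "smooth_on (\<phi> ` (U \<inter> (+) b -` V)) (\<psi> \<circ> (+) b \<circ> inv_into U \<phi>)"
    by (rule smooth_on_cong[OF oT, rotated]) (use c inv in auto)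
qed

text \<open>Translation by \<open>- b\<close> undoes translation by \<open>b\<close>, which gives
  the converse. The equivalence makes \<open>left_translate\<close> respect the value 0 on
  non-smooth functions.\<close>

lemma smooth_fun_left_translation:
  assumes lie: "lie_group A"
  shows "smooth_fun A (\<lambda>q. f (b + q)) \<longleftrightarrow> smooth_fun A f"
proof -
  have A: "smooth_atlas A" using lie by (auto simp: lie_group_def)
  note * = smooth_fun_compose[OF smooth_atlas_open_chart[OF A] A smooth_map_left_translation[OF lie]]
  show ?thesis
    using *[of f b] *[of "\<lambda>q. f (b + q)" "- b"] by (auto simp flip: add.assoc)
qed

lemma left_translate_tangent:
  assumes lie: "lie_group A" and w: "w \<in> tangent_space A p"
  shows "left_translate b w \<in> tangent_space A (b + p)"
proof -
  have A: "smooth_atlas A" using lie by (auto simp: lie_group_def)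
  obtain U \<phi> \<xi> where U: "(U, \<phi>) \<in> A" "p \<in> U" and w: "w = coord_vector A (U, \<phi>) p \<xi>"
    using w unfolding tangent_space_def by auto
  obtain V \<psi> where V: "(V, \<psi>) \<in> A" "b + p \<in> V" by (rule smooth_atlas_cover[OF A])
  have "left_translate b w f = coord_vector A (V, \<psi>) (b + p)
      (frechet_derivative (\<lambda>y. \<psi> (b + inv_into U \<phi> y)) (at (\<phi> p)) \<xi>) f" for f
    by (cases "smooth_fun A f") (simp_all add: left_translate_def w smooth_fun_left_translation[OF lie]
        coord_vector_push[OF A A smooth_map_left_translation[OF lie] U V])
  then have "left_translate b w = coord_vector A (V, \<psi>) (b + p)
      (frechet_derivative (\<lambda>y. \<psi> (b + inv_into U \<phi> y)) (at (\<phi> p)) \<xi>)" ..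
  then show ?thesis using V unfolding tangent_space_def by auto
qed

text \<open>In product coordinates let \<open>G\<close> be \<open>f\<close> composed with the
  multiplication. The value at \<open>b\<close> is the derivative of \<open>G\<close> at
  (coordinates of \<open>b\<close>, coordinates of \<open>p\<close>) in the direction
  \<open>(0, \<xi>)\<close>, and derivatives of the smooth \<open>G\<close> in a fixed direction are
  smooth.\<close>

lemma left_translate_smooth:
  fixes A :: "('g::{topological_group_add, t2_space, second_countable_topology}, 'e::euclidean_space) chart set"
  assumes lie: "lie_group A" and w: "w \<in> tangent_space A p" and f: "smooth_fun A f"
  shows "smooth_fun A (\<lambda>b. left_translate b w f)"
proof (rule smooth_funI)
  have A: "smooth_atlas A" and mult: "smooth_map (prod_atlas A A) A (\<lambda>(a, b). a + b)"
    using lie by (auto simp: lie_group_def)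
  obtain U \<phi> \<xi> where U: "(U, \<phi>) \<in> A" "p \<in> U" and w: "w = coord_vector A (U, \<phi>) p \<xi>"
    using w unfolding tangent_space_def by auto
  fix V \<psi>
  assume V: "(V, \<psi>) \<in> A"
  note c = smooth_atlas_open_chart[OF A U(1)] smooth_atlas_open_chart[OF A V]
  note cp = open_chart_prod[OF c(2) c(1)]
  let ?\<Phi> = "map_prod \<psi> \<phi>"
  let ?G = "\<lambda>y. f ((\<lambda>(a, b). a + b) (inv_into (V \<times> U) ?\<Phi> y))"
  have UV: "(V \<times> U, ?\<Phi>) \<in> prod_atlas A A"
    using U V unfolding prod_atlas_def by blast
  have "open_chart W \<rho>" if "(W, \<rho>) \<in> prod_atlas A A" for W \<rho>
    using that smooth_atlas_open_chart[OF A] unfolding prod_atlas_def by (auto intro: open_chart_prod)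
  from smooth_funD[OF smooth_fun_compose[OF this A mult f] UV]
  have G: "smooth_on (?\<Phi> ` (V \<times> U)) ?G" .
  have inv: "inv_into (V \<times> U) ?\<Phi> (\<psi> a, \<phi> q) = (a, q)" if "a \<in> V" "q \<in> U" for a q
    using open_chart_inv[OF cp, of "(a, q)"] that by simp
  have eq: "left_translate (inv_into V \<psi> y) w f = frechet_derivative ?G (at (y, \<phi> p)) (0, \<xi>)"
    if y: "y \<in> \<psi> ` V" for y
  proof -
    obtain a where a: "a \<in> V" "y = \<psi> a" using y by auto
    have P: "((\<lambda>x. (y, x)) has_derivative (\<lambda>\<xi>. (0, \<xi>))) (at (\<phi> p))"
      by (auto intro!: derivative_eq_intros)
    have "(?G has_derivative frechet_derivative ?G (at (y, \<phi> p))) (at (y, \<phi> p))"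
      using smooth_on_differentiable[OF G, of "(y, \<phi> p)"] a U
      by (force simp: frechet_derivative_works[symmetric])
    from has_derivative_compose[OF P this]
    have "((\<lambda>x. f (a + inv_into U \<phi> x)) has_derivative
        (\<lambda>\<xi>. frechet_derivative ?G (at (y, \<phi> p)) (0, \<xi>))) (at (\<phi> p))"
      by (rule has_derivative_transform_within_open[of _ _ _ _ "\<phi> ` U"])
        (use open_chartD(4)[OF c(1)] U a inv c in auto)
    from fun_cong[OF frechet_derivative_at[OF this], of \<xi>] show ?thesis
      using a c f by (simp add: left_translate_def w coord_vector_apply smooth_fun_left_translation[OF lie])
  qed
  have "smooth_on (\<psi> ` V) (\<lambda>y. frechet_derivative ?G (at (y, \<phi> p)) (0, \<xi>))"
    by (rule smooth_on_compose[OF open_chartD(4)[OF c(2)] open_chartD(4)[OF cp] _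
        smooth_on_frechet_derivative[OF G] smooth_on_Pair_right]) (use U in force)
  then show "smooth_on (\<psi> ` V) (\<lambda>y. left_translate (inv_into V \<psi> y) w f)"
    by (rule smooth_on_cong[OF open_chartD(4)[OF c(2)], rotated]) (simp add: eq)
qed

text \<open>The vector is carried to the identity by \<open>- p\<close> and then spread over the
  group by left translation; associativity makes the field left-invariant and returns
  \<open>w\<close> at \<open>p\<close>.\<close>

lemma left_invariant_extension:
  assumes lie: "lie_group A" and w: "w \<in> tangent_space A p"
  obtains W where "W \<in> lie_algebra A" "W p = w"
proof
  define w0 where "w0 = left_translate (- p) w"
  have w0: "w0 \<in> tangent_space A 0"
    using left_translate_tangent[OF lie w, of "- p"] by (simp add: w0_def)
  show "(\<lambda>b. left_translate b w0) \<in> lie_algebra A"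
    using left_translate_tangent[OF lie w0] left_translate_smooth[OF lie w0]
    by (auto simp: lie_algebra_def vector_fields_def left_translate_def add.assoc)
  show "left_translate p w0 = w"
    by (simp add: w0_def left_translate_def add.assoc[symmetric])
qed

section \<open>The metric on left-invariant fields and Koszul's formula\<close>

lemma inner_product_onD:
  assumes "inner_product_on S b"
  shows "x \<in> S \<Longrightarrow> y \<in> S \<Longrightarrow> b x y = b y x"
    and "x \<in> S \<Longrightarrow> y \<in> S \<Longrightarrow> w \<in> S \<Longrightarrow> b (x + y) w = b x w + b y w"
    and "x \<in> S \<Longrightarrow> w \<in> S \<Longrightarrow> b (c *\<^sub>R x) w = c * b x w"
    and "x \<in> S \<Longrightarrow> (\<And>y. y \<in> S \<Longrightarrow> b x y = 0) \<Longrightarrow> x = 0"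
proof -
  note * = assms[unfolded inner_product_on_def]
  show "x \<in> S \<Longrightarrow> y \<in> S \<Longrightarrow> b x y = b y x"
    using *[THEN conjunct1] by blast
  show "x \<in> S \<Longrightarrow> y \<in> S \<Longrightarrow> w \<in> S \<Longrightarrow> b (x + y) w = b x w + b y w"
    using *[THEN conjunct2, THEN conjunct1] by blast
  show "x \<in> S \<Longrightarrow> w \<in> S \<Longrightarrow> b (c *\<^sub>R x) w = c * b x w"
    using *[THEN conjunct2, THEN conjunct2, THEN conjunct1] by blast
  show "x \<in> S \<Longrightarrow> (\<And>y. y \<in> S \<Longrightarrow> b x y = 0) \<Longrightarrow> x = 0"
    using *[THEN conjunct2, THEN conjunct2, THEN conjunct2] by blast
qed

lemma inner_at_identity_eq:
  assumes "left_invariant_metric A g" "X \<in> lie_algebra A" "Y \<in> lie_algebra A"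
  shows "g p (X p) (Y p) = inner_at_identity g X Y"
proof -
  have "X (p + 0) = left_translate p (X 0)" "Y (p + 0) = left_translate p (Y 0)"
    "X 0 \<in> tangent_space A 0" "Y 0 \<in> tangent_space A 0"
    using assms(2,3) unfolding lie_algebra_def vector_fields_def by blast+
  then show ?thesis
    using assms(1) unfolding left_invariant_metric_def inner_at_identity_def by (metis add.right_neutral)
qed

lemma left_invariant_eqI:
  assumes lie: "lie_group A" and g: "pseudo_riemannian A g"
    and X: "X \<in> vector_fields A" and Y: "Y \<in> vector_fields A"
    and eq: "\<And>W p. W \<in> lie_algebra A \<Longrightarrow> g p (X p) (W p) = g p (Y p) (W p)"
  shows "X = Y"
proof
  fix p
  have A: "smooth_atlas A" using lie by (simp add: lie_group_def)
  have t: "X p \<in> tangent_space A p" "Y p \<in> tangent_space A p"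
    using X Y by (auto simp: vector_fields_def)
  note sub = subspace_tangent_space[OF A, of p]
  have b: "inner_product_on (tangent_space A p) (g p)"
    using g by (simp add: pseudo_riemannian_def)
  \<comment> \<open>The difference is written as a sum with a multiple by -1, because
    \<open>inner_product_on\<close> speaks only of sums and scalar multiples.\<close>
  have neg: "- 1 *\<^sub>R Y p \<in> tangent_space A p" by (rule subspace_scale[OF sub t(2)])
  have "g p (X p + - 1 *\<^sub>R Y p) w = 0" if w: "w \<in> tangent_space A p" for w
  proof -
    obtain W where W: "W \<in> lie_algebra A" "W p = w" by (rule left_invariant_extension[OF lie w])
    have "g p (X p + - 1 *\<^sub>R Y p) w = g p (X p) w + - 1 * g p (Y p) w"
      by (simp only: inner_product_onD(2)[OF b t(1) neg w] inner_product_onD(3)[OF b t(2) w])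
    then show ?thesis using eq[OF W(1), of p] W(2) by simp
  qed
  then have "X p + - 1 *\<^sub>R Y p = 0"
    by (rule inner_product_onD(4)[OF b subspace_add[OF sub t(1) neg]])
  then show "X p = Y p" by simp
qed

text \<open>Symmetry and linearity restrict from the tangent space at the identity. For
  nondegeneracy, a field orthogonal to the algebra at the identity is so at every point, and is
  compared with the zero field.\<close>

lemma inner_at_identity_inner_product:
  assumes lie: "lie_group A" and g: "pseudo_riemannian A g" and li: "left_invariant_metric A g"
  shows "inner_product_on (lie_algebra A) (inner_at_identity g)"
proof -
  have A: "smooth_atlas A" using lie by (simp add: lie_group_def)
  have b: "inner_product_on (tangent_space A 0) (g 0)"
    using g by (simp add: pseudo_riemannian_def)
  have t: "X 0 \<in> tangent_space A 0" if "X \<in> lie_algebra A" for X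
    using that by (simp add: lie_algebra_def vector_fields_def)
  have "X = 0" if X: "X \<in> lie_algebra A" and "\<forall>Y\<in>lie_algebra A. inner_at_identity g X Y = 0" for X
  proof (rule left_invariant_eqI[OF lie g])
    show "X \<in> vector_fields A" using X by (simp add: lie_algebra_def)
    show "0 \<in> vector_fields A" by (rule subspace_0[OF subspace_vector_fields[OF A]])
    note L0 = subspace_0[OF subspace_lie_algebra[OF A]]
    have "g 0 (0 *\<^sub>R X 0) w = 0 * g 0 (X 0) w" if "w \<in> tangent_space A 0" for w
      by (rule inner_product_onD(3)[OF b t[OF X] that])
    then show "g p (X p) (W p) = g p (0 p) (W p)" if "W \<in> lie_algebra A" for p W
      using X that t[OF that] L0 \<open>\<forall>Y\<in>lie_algebra A. inner_at_identity g X Y = 0\<close>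
        inner_at_identity_eq[OF li X that, of p] inner_at_identity_eq[OF li L0 that, of p]
      by (simp add: inner_at_identity_def)
  qed
  then show ?thesis
    using b t unfolding inner_product_on_def
    by (auto simp: inner_at_identity_def scaleR_fun_def[of _ "_ :: 'a vfield"])
qed

text \<open>With \<open>a X Y W\<close> for the pairing of \<open>D X Y\<close> with
  \<open>W\<close>, metric compatibility changes the sign when the last two arguments are swapped,
  and vanishing torsion swaps the first two at the cost of a bracket. Alternating the two moves,
  three times each, returns to \<open>a X Y W\<close> with the opposite sign; the brackets collected
  on the way give the formula.\<close>

lemma koszul_left_invariant:
  assumes lie: "lie_group A" and g: "pseudo_riemannian A g" and li: "left_invariant_metric A g"
    and D: "levi_civita A g D"
    and closed: "\<And>X Y. X \<in> lie_algebra A \<Longrightarrow> Y \<in> lie_algebra A \<Longrightarrow> lie_bracket X Y \<in> lie_algebra A"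
    and XYW: "X \<in> lie_algebra A" "Y \<in> lie_algebra A" "W \<in> lie_algebra A"
  defines "b \<equiv> inner_at_identity g"
  shows "2 * g p (D X Y p) (W p) = b (lie_bracket X Y) W - b (lie_bracket Y W) X - b (lie_bracket X W) Y"
proof -
  have A: "smooth_atlas A" using lie by (simp add: lie_group_def)
  let ?L = "lie_algebra A"
  have LV: "X \<in> vector_fields A" if "X \<in> ?L" for X using that by (simp add: lie_algebra_def)
  have tp: "X p \<in> tangent_space A p" if "X \<in> vector_fields A" for X
    using that by (simp add: vector_fields_def)
  note D = D[unfolded levi_civita_def]
  have D1: "\<forall>X\<in>vector_fields A. \<forall>Y\<in>vector_fields A. D X Y \<in> vector_fields A"
    using D by (elim conjE)
  have D2: "\<forall>X\<in>vector_fields A. \<forall>Y\<in>vector_fields A. D X Y - D Y X = lie_bracket X Y"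
    using D by (elim conjE)
  have D3: "\<forall>X\<in>vector_fields A. \<forall>Y\<in>vector_fields A. \<forall>Z\<in>vector_fields A. \<forall>p.
      X p (\<lambda>q. g q (Y q) (Z q)) = g p (D X Y p) (Z p) + g p (Y p) (D X Z p)"
    using D by (elim conjE)
  have DV: "D X Y p \<in> tangent_space A p" if "X \<in> ?L" "Y \<in> ?L" for X Y
    using D1 that LV tp by blast
  have ipp: "inner_product_on (tangent_space A p) (g p)"
    using g by (simp add: pseudo_riemannian_def)
  define a where "a X Y W = g p (D X Y p) (W p)" for X Y W
  have skew: "a X Y W = - a X W Y" if "X \<in> ?L" "Y \<in> ?L" "W \<in> ?L" for X Y W
  proof -
    have "X p (\<lambda>q. g q (Y q) (W q)) = g p (D X Y p) (W p) + g p (Y p) (D X W p)"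
      using D3 LV[OF that(1)] LV[OF that(2)] LV[OF that(3)] by blast
    moreover have "(\<lambda>q. g q (Y q) (W q)) = (\<lambda>q. inner_at_identity g Y W)"
      using inner_at_identity_eq[OF li that(2,3)] by simp
    moreover have "g p (Y p) (D X W p) = g p (D X W p) (Y p)"
      by (rule inner_product_onD(1)[OF ipp tp[OF LV[OF that(2)]] DV[OF that(1,3)]])
    ultimately show ?thesis
      using tangent_const[OF tp[OF LV[OF that(1)]]] by (simp add: a_def)
  qed
  have torsion: "a X Y W = b (lie_bracket X Y) W + a Y X W" if "X \<in> ?L" "Y \<in> ?L" "W \<in> ?L" for X Y W
  proof -
    have "D X Y - D Y X = lie_bracket X Y"
      using D2 LV[OF that(1)] LV[OF that(2)] by blast
    then have "D X Y p = lie_bracket X Y p + D Y X p" by (metis diff_add_cancel plus_fun_apply)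
    then have "a X Y W = g p (lie_bracket X Y p) (W p) + a Y X W"
      using inner_product_onD(2)[OF ipp tp[OF LV[OF closed[OF that(1,2)]]] DV[OF that(2,1)] tp[OF LV[OF that(3)]]]
      by (simp add: a_def)
    then show ?thesis
      using inner_at_identity_eq[OF li closed[OF that(1,2)] that(3)] by (simp add: b_def)
  qed
  \<comment> \<open>The torsion identity for \<open>W, X\<close> added to the one for
    \<open>X, W\<close> cancels the connection terms.\<close>
  have "b (lie_bracket W X) Y = - b (lie_bracket X W) Y"
    using torsion[OF XYW(3,1,2)] torsion[OF XYW(1,3,2)] by simp
  then show ?thesis
    using torsion[OF XYW(1,2,3)] skew[OF XYW(2,1,3)] torsion[OF XYW(2,3,1)] skew[OF XYW(3,2,1)]
      torsion[OF XYW(3,1,2)] skew[OF XYW(1,3,2)]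
    by (simp add: a_def)
qed

section \<open>Inner product spaces with an adapted frame\<close>

text \<open>The linear algebra of the decomposition, free of any bracket: \<open>C\<close> stands
  for the centre. That the four frames together span \<open>L\<close> is a consequence, shown in
  \<open>decompose\<close>.\<close>

locale adapted_frame =
  fixes L C U V Z E :: "'a::real_vector set" and b :: "'a \<Rightarrow> 'a \<Rightarrow> real"
    and m r s :: nat and ub vb zb eb :: "nat \<Rightarrow> 'a" and \<epsilon> \<epsilon>' :: "nat \<Rightarrow> real" and \<iota> :: "'a \<Rightarrow> 'a"
  assumes L: "subspace L" and C: "subspace C" "C \<subseteq> L" and inner: "inner_product_on L b"
    and U: "U = C \<inter> orth L b C" and V: "V \<subseteq> L" "totally_null b V"
    and Z: "Z = C \<inter> orth L b U \<inter> orth L b V"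
    and E: "E = orth L b U \<inter> orth L b V \<inter> orth L b Z"
    and ub: "basis_family m ub U"
    and vb: "basis_family m vb V" "\<And>i k. i < m \<Longrightarrow> k < m \<Longrightarrow> b (ub i) (vb k) = (if i = k then 1 else 0)"
    and zb: "basis_family r zb Z" "orthonormal_family b r zb \<epsilon>"
    and eb: "basis_family s eb E" "orthonormal_family b s eb \<epsilon>'"
    and iota: "linear \<iota>"
      "\<And>i. i < m \<Longrightarrow> \<iota> (ub i) = vb i"
      "\<And>i. i < m \<Longrightarrow> \<iota> (vb i) = ub i"
      "\<And>i. i < r \<Longrightarrow> \<iota> (zb i) = \<epsilon> i *\<^sub>R zb i"
      "\<And>i. i < s \<Longrightarrow> \<iota> (eb i) = \<epsilon>' i *\<^sub>R eb i"
begin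

lemmas sym = inner_product_onD(1)[OF inner]
lemmas add_left = inner_product_onD(2)[OF inner]
lemmas scale_left = inner_product_onD(3)[OF inner]

lemma add_right: "x \<in> L \<Longrightarrow> y \<in> L \<Longrightarrow> w \<in> L \<Longrightarrow> b w (x + y) = b w x + b w y"
  using add_left sym subspace_add[OF L] by metis

lemma scale_right: "x \<in> L \<Longrightarrow> w \<in> L \<Longrightarrow> b w (c *\<^sub>R x) = c * b w x"
  using scale_left sym subspace_scale[OF L] by metis

lemma diff_left:
  assumes "x \<in> L" "y \<in> L" "w \<in> L"
  shows "b (x - y) w = b x w - b y w"
  using add_left[OF assms(1) subspace_scale[OF L assms(2), of "- 1"] assms(3)] scale_left[OF assms(2,3), of "- 1"]
  by simp

lemma sum_left:
  assumes "\<And>i. i \<in> I \<Longrightarrow> f i \<in> L" "w \<in> L"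
  shows "b (\<Sum>i\<in>I. c i *\<^sub>R f i) w = (\<Sum>i\<in>I. c i * b (f i) w)"
  using assms(1)
proof (induction I rule: infinite_finite_induct)
  case (insert i I)
  then show ?case
    using subspace_sum[OF L, of I "\<lambda>i. c i *\<^sub>R f i"] subspace_scale[OF L]
    by (simp add: add_left scale_left assms(2))
qed (use scale_left[OF subspace_0[OF L] assms(2), of 0] in simp_all)

lemma sum_mem: "(\<And>i. i < n \<Longrightarrow> f i \<in> S) \<Longrightarrow> subspace S \<Longrightarrow> (\<Sum>i<n. c i *\<^sub>R f i) \<in> S"
  by (intro subspace_sum subspace_scale) auto

lemma subsets: "U \<subseteq> L" "V \<subseteq> L" "Z \<subseteq> L" "E \<subseteq> L"
  using U V Z E C by (auto simp: orth_def)

lemma basis_mem: "basis_family n w S \<Longrightarrow> i < n \<Longrightarrow> w i \<in> S"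
  unfolding basis_family_def by (auto intro: span_base)

lemmas frame_mem = basis_mem[OF ub] basis_mem[OF vb(1)] basis_mem[OF zb(1)] basis_mem[OF eb(1)]

lemma basis_subspace: "basis_family n w S \<Longrightarrow> subspace S"
  unfolding basis_family_def using subspace_span by blast

lemmas part_subspace = basis_subspace[OF ub] basis_subspace[OF vb(1)] basis_subspace[OF zb(1)]
  basis_subspace[OF eb(1)]

lemma basis_subset: "basis_family n w S \<Longrightarrow> subspace T \<Longrightarrow> (\<And>i. i < n \<Longrightarrow> w i \<in> T) \<Longrightarrow> S \<subseteq> T"
  unfolding basis_family_def using span_minimal[of "w ` {..<n}" T] by blast

lemma frame_in_L:
  "i < m \<Longrightarrow> ub i \<in> L" "i < m \<Longrightarrow> vb i \<in> L" "i < r \<Longrightarrow> zb i \<in> L" "i < s \<Longrightarrow> eb i \<in> L"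
  using frame_mem subsets by blast+

lemma orthogonal:
  "x \<in> U \<Longrightarrow> y \<in> U \<Longrightarrow> b x y = 0" "x \<in> V \<Longrightarrow> y \<in> V \<Longrightarrow> b x y = 0"
  "x \<in> Z \<Longrightarrow> y \<in> U \<Longrightarrow> b x y = 0" "x \<in> Z \<Longrightarrow> y \<in> V \<Longrightarrow> b x y = 0"
  "x \<in> E \<Longrightarrow> y \<in> U \<Longrightarrow> b x y = 0" "x \<in> E \<Longrightarrow> y \<in> V \<Longrightarrow> b x y = 0" "x \<in> E \<Longrightarrow> y \<in> Z \<Longrightarrow> b x y = 0"
  "x \<in> U \<Longrightarrow> y \<in> Z \<Longrightarrow> b x y = 0" "x \<in> V \<Longrightarrow> y \<in> Z \<Longrightarrow> b x y = 0"
  "x \<in> U \<Longrightarrow> y \<in> E \<Longrightarrow> b x y = 0" "x \<in> V \<Longrightarrow> y \<in> E \<Longrightarrow> b x y = 0" "x \<in> Z \<Longrightarrow> y \<in> E \<Longrightarrow> b x y = 0"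
proof -
  show *: "x \<in> U \<Longrightarrow> y \<in> U \<Longrightarrow> b x y = 0" "x \<in> V \<Longrightarrow> y \<in> V \<Longrightarrow> b x y = 0"
    "x \<in> Z \<Longrightarrow> y \<in> U \<Longrightarrow> b x y = 0" "x \<in> Z \<Longrightarrow> y \<in> V \<Longrightarrow> b x y = 0"
    "x \<in> E \<Longrightarrow> y \<in> U \<Longrightarrow> b x y = 0" "x \<in> E \<Longrightarrow> y \<in> V \<Longrightarrow> b x y = 0"
    "x \<in> E \<Longrightarrow> y \<in> Z \<Longrightarrow> b x y = 0" for x y
    using U V(2) Z E unfolding orth_def totally_null_def by blast+
  show "x \<in> U \<Longrightarrow> y \<in> Z \<Longrightarrow> b x y = 0" "x \<in> V \<Longrightarrow> y \<in> Z \<Longrightarrow> b x y = 0"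
    "x \<in> U \<Longrightarrow> y \<in> E \<Longrightarrow> b x y = 0" "x \<in> V \<Longrightarrow> y \<in> E \<Longrightarrow> b x y = 0" "x \<in> Z \<Longrightarrow> y \<in> E \<Longrightarrow> b x y = 0"
    using sym[of x y] *(3-7)[of y x] subsets by auto
qed

lemma pairing:
  "i < m \<Longrightarrow> k < m \<Longrightarrow> b (ub i) (vb k) = (if i = k then 1 else 0)"
  "i < m \<Longrightarrow> k < m \<Longrightarrow> b (vb i) (ub k) = (if i = k then 1 else 0)"
  "i < r \<Longrightarrow> k < r \<Longrightarrow> b (zb i) (zb k) = (if i = k then \<epsilon> i else 0)"
  "i < s \<Longrightarrow> k < s \<Longrightarrow> b (eb i) (eb k) = (if i = k then \<epsilon>' i else 0)"
  using vb(2) sym[OF frame_in_L(2) frame_in_L(1)] zb(2) eb(2)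
  by (auto simp: orthonormal_family_def)

lemma signs: "i < r \<Longrightarrow> \<epsilon> i * \<epsilon> i = 1" "i < s \<Longrightarrow> \<epsilon>' i * \<epsilon>' i = 1"
  using zb(2) eb(2) unfolding orthonormal_family_def by force+

section \<open>Coefficients and the orthogonal decomposition\<close>

lemma orth_basis:
  assumes "basis_family n w S" "S \<subseteq> L" "x \<in> L" "\<And>i. i < n \<Longrightarrow> b x (w i) = 0"
  shows "x \<in> orth L b S"
proof -
  have "subspace {y \<in> L. b x y = 0}"
    using L assms(3) scale_right[OF subspace_0[OF L] assms(3), of 0]
    by (auto simp: subspace_def add_right scale_right)
  from basis_subset[OF assms(1) this] show ?thesis
    using assms basis_mem[OF assms(1)] by (auto simp: orth_def)
qed

text \<open>The frames of \<open>U\<close> and \<open>V\<close> are dual to each other, so each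
  reads off the coefficients of the other. On \<open>Z\<close> and \<open>E\<close> the sign in the
  coefficient cancels against the square norm of the frame vector.\<close>

lemma coefficient:
  "k < m \<Longrightarrow> b (\<Sum>i<m. c i *\<^sub>R ub i) (vb k) = c k"
  "k < m \<Longrightarrow> b (\<Sum>i<m. c i *\<^sub>R vb i) (ub k) = c k"
  "k < r \<Longrightarrow> b (\<Sum>i<r. (\<epsilon> i * c i) *\<^sub>R zb i) (zb k) = c k"
  "k < s \<Longrightarrow> b (\<Sum>i<s. (\<epsilon>' i * c i) *\<^sub>R eb i) (eb k) = c k"
  by (subst sum_left; simp add: frame_in_L pairing signs if_distrib[of "\<lambda>x. _ * x"]
      cong: sum.cong_simp if_cong)+

text \<open>Subtracting the components along \<open>U\<close>, \<open>V\<close> and \<open>Z\<close>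
  leaves a vector orthogonal to all three, and that is the definition of \<open>E\<close>.\<close>

lemma decompose:
  assumes x: "x \<in> L"
  obtains a c d f where "a \<in> U" "c \<in> V" "d \<in> Z" "f \<in> E" "x = a + c + d + f"
proof -
  define a where "a = (\<Sum>i<m. b x (vb i) *\<^sub>R ub i)"
  define c where "c = (\<Sum>i<m. b x (ub i) *\<^sub>R vb i)"
  define d where "d = (\<Sum>i<r. (\<epsilon> i * b x (zb i)) *\<^sub>R zb i)"
  have mem: "a \<in> U" "c \<in> V" "d \<in> Z"
    unfolding a_def c_def d_def by (intro sum_mem frame_mem part_subspace; assumption)+
  note memL = subsetD[OF subsets(1) mem(1)] subsetD[OF subsets(2) mem(2)] subsetD[OF subsets(3) mem(3)]
  let ?f = "x - a - c - d"
  have fL: "?f \<in> L" using x memL L by (intro subspace_diff) auto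
  have f: "b ?f y = b x y - b a y - b c y - b d y" if "y \<in> L" for y
    using x memL that L by (simp add: diff_left subspace_diff)
  note coeffs = coefficient(1)[of _ "\<lambda>i. b x (vb i)", folded a_def]
    coefficient(2)[of _ "\<lambda>i. b x (ub i)", folded c_def]
    coefficient(3)[of _ "\<lambda>i. b x (zb i)", folded d_def]
  have "?f \<in> orth L b U" "?f \<in> orth L b V" "?f \<in> orth L b Z"
    by (intro orth_basis[OF ub subsets(1) fL] orth_basis[OF vb(1) subsets(2) fL]
        orth_basis[OF zb(1) subsets(3) fL]; use mem in \<open>simp add: f frame_in_L orthogonal frame_mem coeffs\<close>)+
  then have "?f \<in> E" using E by blast
  then show thesis using that[of a c d ?f] mem by simp
qed

text \<open>A central \<open>x\<close> is already orthogonal to \<open>U\<close>. Only its pairing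
  with \<open>V\<close> has to be removed, which an element of \<open>U\<close> does without leaving
  \<open>C\<close>.\<close>

lemma decompose_center:
  assumes x: "x \<in> C"
  obtains a d where "a \<in> U" "d \<in> Z" "x = a + d"
proof -
  define a where "a = (\<Sum>i<m. b x (vb i) *\<^sub>R ub i)"
  have a: "a \<in> U" unfolding a_def by (intro sum_mem frame_mem part_subspace)
  have aC: "a \<in> C" and aL: "a \<in> L" and xL: "x \<in> L" using a U x C by auto
  have dC: "x - a \<in> C" and dL: "x - a \<in> L" using C x aC subspace_diff by blast+
  have "x - a \<in> orth L b U"
    using dL dC U sym[OF dL] by (auto simp: orth_def)
  moreover have "x - a \<in> orth L b V"
    by (rule orth_basis[OF vb(1) subsets(2) dL])
      (simp add: diff_left[OF xL aL] frame_in_L coefficient(1)[of _ "\<lambda>i. b x (vb i)", folded a_def])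
  ultimately have "x - a \<in> Z" using Z dC by blast
  then show thesis using that[of a "x - a"] a by simp
qed

lemma orth_center:
  assumes "y \<in> U \<or> y \<in> E" "x \<in> C"
  shows "b y x = 0"
proof -
  obtain a d where ad: "a \<in> U" "d \<in> Z" "x = a + d" by (rule decompose_center[OF assms(2)])
  have "b y x = b y a + b y d" using ad assms subsets by (auto intro!: add_right)
  then show ?thesis using assms(1) ad orthogonal by auto
qed

lemma iota_iota:
  assumes x: "x \<in> L"
  shows "\<iota> (\<iota> x) = x"
proof -
  have S: "subspace {x. \<iota> (\<iota> x) = x}"
    using iota(1) by (auto simp: subspace_def linear_0 linear_add linear_scale)
  have "U \<subseteq> {x. \<iota> (\<iota> x) = x}" by (rule basis_subset[OF ub S]) (simp add: iota)
  moreover have "V \<subseteq> {x. \<iota> (\<iota> x) = x}" by (rule basis_subset[OF vb(1) S]) (simp add: iota)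
  moreover have "Z \<subseteq> {x. \<iota> (\<iota> x) = x}"
    by (rule basis_subset[OF zb(1) S]) (simp add: iota linear_scale signs)
  moreover have "E \<subseteq> {x. \<iota> (\<iota> x) = x}"
    by (rule basis_subset[OF eb(1) S]) (simp add: iota linear_scale signs)
  moreover obtain a c d f where "a \<in> U" "c \<in> V" "d \<in> Z" "f \<in> E" "x = a + c + d + f"
    by (rule decompose[OF x])
  ultimately show ?thesis using linear_add[OF iota(1)] by (simp add: subset_iff)
qed

text \<open>The representing vector takes as coefficients the values of the functional on the dual
  frame, with signs on \<open>Z\<close> and \<open>E\<close>. Uniqueness is nondegeneracy, and it is
  what the definite description in \<open>adjoint_on\<close> requires.\<close>

lemma functional_representable:
  assumes add: "\<And>x y. x \<in> L \<Longrightarrow> y \<in> L \<Longrightarrow> \<phi> (x + y) = \<phi> x + \<phi> y"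
    and scale: "\<And>c x. x \<in> L \<Longrightarrow> \<phi> (c *\<^sub>R x) = c * \<phi> x"
  shows "\<exists>!c. c \<in> L \<and> (\<forall>y\<in>L. b c y = \<phi> y)"
proof (rule ex_ex1I)
  define cu where "cu = (\<Sum>i<m. \<phi> (vb i) *\<^sub>R ub i)"
  define cv where "cv = (\<Sum>i<m. \<phi> (ub i) *\<^sub>R vb i)"
  define cz where "cz = (\<Sum>i<r. (\<epsilon> i * \<phi> (zb i)) *\<^sub>R zb i)"
  define ce where "ce = (\<Sum>i<s. (\<epsilon>' i * \<phi> (eb i)) *\<^sub>R eb i)"
  have mem: "cu \<in> U" "cv \<in> V" "cz \<in> Z" "ce \<in> E"
    unfolding cu_def cv_def cz_def ce_def by (intro sum_mem frame_mem part_subspace; assumption)+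
  note memL = subsetD[OF subsets(1) mem(1)] subsetD[OF subsets(2) mem(2)]
    subsetD[OF subsets(3) mem(3)] subsetD[OF subsets(4) mem(4)]
  let ?c = "cu + cv + cz + ce" and ?S = "{y \<in> L. b (cu + cv + cz + ce) y = \<phi> y}"
  have cL: "?c \<in> L" using memL L by (intro subspace_add)
  have c: "b ?c y = b cu y + b cv y + b cz y + b ce y" if "y \<in> L" for y
    using memL that L by (simp add: add_left subspace_add)
  \<comment> \<open>The set of agreement is a subspace, so checking it on the four frames yields the
    parts, and \<open>decompose\<close> then yields all of \<open>L\<close>.\<close>
  have S: "subspace ?S"
    using L cL scale[OF subspace_0[OF L], of 0] scale_right[OF subspace_0[OF L] cL, of 0]
    by (auto simp: subspace_def add_right scale_right add scale)
  note coeffs = coefficient(1)[of _ "\<lambda>i. \<phi> (vb i)", folded cu_def]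
    coefficient(2)[of _ "\<lambda>i. \<phi> (ub i)", folded cv_def]
    coefficient(3)[of _ "\<lambda>i. \<phi> (zb i)", folded cz_def]
    coefficient(4)[of _ "\<lambda>i. \<phi> (eb i)", folded ce_def]
  have "U \<subseteq> ?S" "V \<subseteq> ?S" "Z \<subseteq> ?S" "E \<subseteq> ?S"
    by (intro basis_subset[OF ub S] basis_subset[OF vb(1) S] basis_subset[OF zb(1) S]
        basis_subset[OF eb(1) S]; use mem in \<open>simp add: c frame_in_L orthogonal frame_mem coeffs\<close>)+
  note parts = this
  have "y \<in> ?S" if yL: "y \<in> L" for y
  proof -
    obtain a c d f where "a \<in> U" "c \<in> V" "d \<in> Z" "f \<in> E" and y: "y = a + c + d + f"
      by (rule decompose[OF yL])
    then show ?thesis unfolding y by (intro subspace_add[OF S] parts[THEN subsetD])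
  qed
  then show "\<exists>c. c \<in> L \<and> (\<forall>y\<in>L. b c y = \<phi> y)" using cL by blast
next
  fix c d
  assume c: "c \<in> L \<and> (\<forall>y\<in>L. b c y = \<phi> y)" and d: "d \<in> L \<and> (\<forall>y\<in>L. b d y = \<phi> y)"
  then have "c - d \<in> L" "\<forall>y\<in>L. b (c - d) y = 0" by (auto simp: diff_left subspace_diff[OF L])
  then have "c - d = 0" by (blast intro: inner_product_onD(4)[OF inner])
  then show "c = d" by simp
qed

lemma adjoint_on_works:
  assumes T: "\<And>y. y \<in> L \<Longrightarrow> T y \<in> L" "\<And>x y. x \<in> L \<Longrightarrow> y \<in> L \<Longrightarrow> T (x + y) = T x + T y"
    "\<And>c x. x \<in> L \<Longrightarrow> T (c *\<^sub>R x) = c *\<^sub>R T x" and a: "a \<in> L"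
  shows "adjoint_on L b T a \<in> L" "y \<in> L \<Longrightarrow> b (adjoint_on L b T a) y = b a (T y)"
proof -
  have "\<exists>!c. c \<in> L \<and> (\<forall>y\<in>L. b c y = b a (T y))"
    by (rule functional_representable) (simp_all add: T a add_right scale_right)
  from theI'[OF this] show "adjoint_on L b T a \<in> L" "y \<in> L \<Longrightarrow> b (adjoint_on L b T a) y = b a (T y)"
    unfolding adjoint_on_def by auto
qed

end

section \<open>The connection of a 2-step nilpotent group\<close>

lemma subspace_lie_center:
  assumes A: "smooth_atlas A"
  shows "subspace (lie_center (lie_algebra A))"
proof -
  let ?L = "lie_algebra A"
  \<comment> \<open>Skew symmetry moves the central element to the second slot, where linearity of
    the bracket is available.\<close>
  have eq: "lie_center ?L = {X \<in> ?L. \<forall>Y\<in>?L. lie_bracket Y X = 0}"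
    unfolding lie_center_def using lie_bracket_skew by (metis neg_equal_0_iff_equal)
  have VF: "X \<in> vector_fields A" if "X \<in> ?L" for X using that by (simp add: lie_algebra_def)
  have "lie_bracket Y 0 = 0" if "Y \<in> ?L" for Y
    using lie_bracket_scale_right[OF A VF[OF that] VF[OF that], of 0] by simp
  then show ?thesis
    unfolding eq using subspace_lie_algebra[OF A] VF
    by (auto simp: subspace_def lie_bracket_add_right[OF A] lie_bracket_scale_right[OF A])
qed

theorem theorem3p1:
  fixes A :: "('g::{topological_group_add, t2_space, second_countable_topology}, 'e::euclidean_space) chart set"
    and g :: "'g metric_tensor"
    and D :: "'g vfield \<Rightarrow> 'g vfield \<Rightarrow> 'g vfield"
    and \<nn> \<zz> \<UU> \<VV> \<ZZ> \<EE> :: "'g vfield set"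
    and ip :: "'g vfield \<Rightarrow> 'g vfield \<Rightarrow> real"
    and m r s :: nat
    and ub vb zb eb :: "nat \<Rightarrow> 'g vfield"
    and \<epsilon> \<epsilon>' :: "nat \<Rightarrow> real"
    and \<iota> :: "'g vfield \<Rightarrow> 'g vfield"
    and j :: "'g vfield \<Rightarrow> 'g vfield \<Rightarrow> 'g vfield"
    and u u' v v' z z' e e' x :: "'g vfield"
  assumes lie: "lie_group A"
    and conn: "connected (UNIV :: 'g set)"
    and metric: "pseudo_riemannian A g" "left_invariant_metric A g"
    and nabla: "levi_civita A g D"
    and nn: "\<nn> = lie_algebra A"
    and zz: "\<zz> = lie_center \<nn>"
    and two_step: "\<And>X Y. X \<in> \<nn> \<Longrightarrow> Y \<in> \<nn> \<Longrightarrow> lie_bracket X Y \<in> \<zz>"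
    and ip: "ip = inner_at_identity g"
    and UU: "\<UU> = \<zz> \<inter> orth \<nn> ip \<zz>"
    and VV: "subspace \<VV>" "\<VV> \<subseteq> \<nn>" "totally_null ip \<VV>" "dim \<VV> = dim \<UU>"
      "dually_paired ip \<UU> \<VV>"
    and ZZ: "\<ZZ> = \<zz> \<inter> orth \<nn> ip \<UU> \<inter> orth \<nn> ip \<VV>"
    and EE: "\<EE> = orth \<nn> ip \<UU> \<inter> orth \<nn> ip \<VV> \<inter> orth \<nn> ip \<ZZ>"
    and ub: "basis_family m ub \<UU>"
    and vb: "basis_family m vb \<VV>" "\<And>i k. i < m \<Longrightarrow> k < m \<Longrightarrow> ip (ub i) (vb k) = (if i = k then 1 else 0)"
    and zb: "basis_family r zb \<ZZ>" "orthonormal_family ip r zb \<epsilon>"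
    and eb: "basis_family s eb \<EE>" "orthonormal_family ip s eb \<epsilon>'"
    and iota: "linear \<iota>"
      "\<And>i. i < m \<Longrightarrow> \<iota> (ub i) = vb i"
      "\<And>i. i < m \<Longrightarrow> \<iota> (vb i) = ub i"
      "\<And>i. i < r \<Longrightarrow> \<iota> (zb i) = \<epsilon> i *\<^sub>R zb i"
      "\<And>i. i < s \<Longrightarrow> \<iota> (eb i) = \<epsilon>' i *\<^sub>R eb i"
    and j: "j = j_map \<nn> ip \<iota>"
    and mem: "u \<in> \<UU>" "u' \<in> \<UU>" "z \<in> \<ZZ>" "z' \<in> \<ZZ>" "v \<in> \<VV>" "v' \<in> \<VV>" "e \<in> \<EE>" "e' \<in> \<EE>"
      "x \<in> {a + b | a b. a \<in> \<VV> \<and> b \<in> \<EE>}"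
  shows "D u u' = 0 \<and> D u z = 0 \<and> D z u = 0 \<and> D z z' = 0 \<and>
    D u v = 0 \<and> D v u = 0 \<and> D u e = 0 \<and> D e u = 0 \<and>
    D z x = - ((1/2) *\<^sub>R \<iota> (j (\<iota> z) x)) \<and> D x z = - ((1/2) *\<^sub>R \<iota> (j (\<iota> z) x)) \<and>
    D v v' = (1/2) *\<^sub>R (lie_bracket v v' - \<iota> (j (\<iota> v) v') - \<iota> (j (\<iota> v') v)) \<and>
    D v e = (1/2) *\<^sub>R (lie_bracket v e - \<iota> (j (\<iota> v) e)) \<and>
    D e v = (1/2) *\<^sub>R (lie_bracket e v - \<iota> (j (\<iota> v) e)) \<and>
    D e e' = (1/2) *\<^sub>R lie_bracket e e'"
proof -
  have A: "smooth_atlas A" using lie by (simp add: lie_group_def)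
  have VF: "X \<in> vector_fields A" if "X \<in> \<nn>" for X using that nn by (simp add: lie_algebra_def)
  have inner: "inner_product_on \<nn> ip"
    unfolding nn ip by (rule inner_at_identity_inner_product[OF lie metric])
  interpret adapted_frame \<nn> \<zz> \<UU> \<VV> \<ZZ> \<EE> ip m r s ub vb zb eb \<epsilon> \<epsilon>' \<iota>
  proof (rule adapted_frame.intro)
    show "subspace \<nn>" unfolding nn by (rule subspace_lie_algebra[OF A])
    show "subspace \<zz>" unfolding zz nn by (rule subspace_lie_center[OF A])
    show "\<zz> \<subseteq> \<nn>" unfolding zz by (auto simp: lie_center_def)
  qed (fact inner UU VV(2,3) ZZ EE ub vb zb eb iota)+
  \<comment> \<open>Closure under brackets comes from the two-step condition, the centre being
    contained in the algebra.\<close>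
  have closed: "lie_bracket X Y \<in> \<nn>" if "X \<in> \<nn>" "Y \<in> \<nn>" for X Y
    using two_step[OF that] C by blast
  define ad' where "ad' X = adjoint_on \<nn> ip (lie_bracket X)" for X
  have ad': "ad' X Y \<in> \<nn>" "W \<in> \<nn> \<Longrightarrow> ip (ad' X Y) W = ip Y (lie_bracket X W)"
    if "X \<in> \<nn>" "Y \<in> \<nn>" for X Y W
    unfolding ad'_def using that
    by (auto intro!: adjoint_on_works closed lie_bracket_add_right[OF A] lie_bracket_scale_right[OF A] VF)
  \<comment> \<open>Left-invariance of \<open>D X Y\<close> is not known beforehand but comes out of
    this identity, so the two fields are compared at every \<open>p\<close> rather than only at the
    identity.\<close>
  have nabla_eq: "D X Y = (1/2) *\<^sub>R (lie_bracket X Y - ad' Y X - ad' X Y)"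
    if X: "X \<in> \<nn>" and Y: "Y \<in> \<nn>" for X Y
  proof (rule left_invariant_eqI[OF lie metric(1)])
    let ?R = "(1/2) *\<^sub>R (lie_bracket X Y - ad' Y X - ad' X Y)"
    note mems = closed[OF X Y] ad'(1)[OF X Y] ad'(1)[OF Y X]
    have R: "?R \<in> \<nn>" by (intro subspace_scale subspace_diff L mems)
    then show "?R \<in> vector_fields A" by (rule VF)
    show "D X Y \<in> vector_fields A"
      using nabla VF[OF X] VF[OF Y] unfolding levi_civita_def by (elim conjE) blast
    fix W p
    assume W: "W \<in> lie_algebra A"
    then have Wn: "W \<in> \<nn>" by (simp add: nn)
    have "2 * g p (D X Y p) (W p) = ip (lie_bracket X Y) W - ip (lie_bracket Y W) X - ip (lie_bracket X W) Y"
      unfolding ip using X Y W closed unfolding nn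
      by (intro koszul_left_invariant[OF lie metric nabla])
    also have "\<dots> = ip (lie_bracket X Y) W - ip (ad' Y X) W - ip (ad' X Y) W"
      using X Y Wn by (simp add: ad' sym[OF closed])
    also have "\<dots> = 2 * ip ?R W"
      using Wn mems L by (simp add: scale_left diff_left subspace_diff)
    also have "ip ?R W = g p (?R p) (W p)"
      using inner_at_identity_eq[OF metric(2), of ?R W p] R W by (simp add: ip nn)
    finally show "g p (D X Y p) (W p) = g p (?R p) (W p)" by simp
  qed
  have ad'_center: "ad' X Y = 0" if "X \<in> \<zz>" "Y \<in> \<nn>" for X Y
  proof (rule inner_product_onD(4)[OF inner])
    have X: "X \<in> \<nn>" using that C by blast
    show "ad' X Y \<in> \<nn>" by (rule ad'(1)[OF X that(2)])
    show "ip (ad' X Y) W = 0" if W: "W \<in> \<nn>" for W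
      using ad'(2)[OF X \<open>Y \<in> \<nn>\<close> W] \<open>X \<in> \<zz>\<close> W scale_right[OF subspace_0[OF L] \<open>Y \<in> \<nn>\<close>, of 0]
      by (simp add: zz lie_center_def)
  qed
  have ad'_orth: "ad' X Y = 0" if "X \<in> \<nn>" "Y \<in> \<UU> \<or> Y \<in> \<EE>" for X Y
  proof (rule inner_product_onD(4)[OF inner])
    have Y: "Y \<in> \<nn>" using that subsets by blast
    show "ad' X Y \<in> \<nn>" by (rule ad'(1)[OF that(1) Y])
    show "ip (ad' X Y) W = 0" if W: "W \<in> \<nn>" for W
      using ad'(2)[OF \<open>X \<in> \<nn>\<close> Y W] orth_center[OF \<open>Y \<in> \<UU> \<or> Y \<in> \<EE>\<close> two_step[OF \<open>X \<in> \<nn>\<close> W]]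
      by simp
  qed
  have bracket: "lie_bracket X Y = 0" "lie_bracket Y X = 0" if "X \<in> \<zz>" "Y \<in> \<nn>" for X Y
    using that lie_bracket_skew[of Y X] by (simp_all add: zz lie_center_def)
  have j_eq: "\<iota> (j (\<iota> X) Y) = ad' Y X" if "X \<in> \<nn>" "Y \<in> \<nn>" for X Y
    using that by (simp add: j j_map_def iota_iota ad' flip: ad'_def)
  have center: "u \<in> \<zz>" "u' \<in> \<zz>" "z \<in> \<zz>" "z' \<in> \<zz>"
    using mem U Z by blast+
  have x: "x \<in> \<nn>" using mem(9) subsets subspace_add[OF L] by blast
  have all: "u \<in> \<nn>" "u' \<in> \<nn>" "z \<in> \<nn>" "z' \<in> \<nn>" "v \<in> \<nn>" "v' \<in> \<nn>" "e \<in> \<nn>" "e' \<in> \<nn>"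
    using mem subsets by blast+
  \<comment> \<open>An adjoint term \<open>ad' X Y\<close> can survive only for \<open>X\<close> not
    known to be central and \<open>Y\<close> in \<open>\<ZZ>\<close> or \<open>\<VV>\<close>. This
    leaves \<open>ad' x z\<close>, \<open>ad' v' v\<close>, \<open>ad' v v'\<close> and
    \<open>ad' e v\<close>, which \<open>j_eq\<close> rewrites; brackets with a central entry
    vanish.\<close>
  show ?thesis
    using mem(1-8) center all x by (simp add: nabla_eq ad'_center ad'_orth bracket j_eq)
qed

end
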